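(* Let $\mathcal{V}$ be a variety of groups and let $G\in\mathcal{V}$ be an $m$-generated group, $m\ge 2$. Suppose $G$ contains a finitely generated subgroup $D$ of infinite index in $G$ such that $D$ discriminates the $\mathcal{V}$-free group $F_\infty(\mathcal{V})$ of countably infinite rank. Then for an arbitrary variety of groups $\mathcal{U}$, the $\mathcal{U}\mathcal{V}$-free group $F_\infty(\mathcal{U}\mathcal{V})$ of countably infinite rank is discriminated by some $m$-generated group belonging to $\mathcal{U}\mathcal{V}$. Consequently, the basis rank of $\mathcal{U}\mathcal{V}$ is at most $m$.
   Context: A group $G$ is discriminated by a group $D$ if for every finite subset $S\subset G$ there is a homomorphism $G\to D$ that is injective on $S$. For a variety $\mathcal{V}$, $F_\infty(\mathcal{V})$ is the relatively free group of $\mathcal{V}$ of countably infinite rank. The product $\mathcal{U}\mathcal{V}$ is the variety of all groups $G$ having a normal subgroup $N\in\mathcal{U}$ with $G/N\in\mathcal{V}$. A variety has basis rank $d$ if it is generated by its $d$-generated groups but not by its $(d-1)$-generated groups; "basis rank at most $m$" means it is generated by its $m$-generated groups. *)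

theory Defs
  imports "HOL-Algebra.Coset" "HOL-Algebra.Generated_Groups"
begin

text \<open>Group words in the countably many variables x_0, x_1, ...:
  a letter (True, i) stands for x_i, a letter (False, i) for x_i^(-1).\<close>
type_synonym word = "(bool \<times> nat) list"

definition eval_word :: "('g, 'b) monoid_scheme \<Rightarrow> (nat \<Rightarrow> 'g) \<Rightarrow> word \<Rightarrow> 'g" where
  "eval_word G a w =
     foldr (\<lambda>(b, i) x. (if b then a i else inv\<^bsub>G\<^esub> (a i)) \<otimes>\<^bsub>G\<^esub> x) w \<one>\<^bsub>G\<^esub>"

definition satisfies_law :: "('g, 'b) monoid_scheme \<Rightarrow> word \<Rightarrow> bool" where
  "satisfies_law G w \<longleftrightarrow> (\<forall>a. (\<forall>i. a i \<in> carrier G) \<longrightarrow> eval_word G a w = \<one>\<^bsub>G\<^esub>)"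

text \<open>A variety of groups is given by a set L of laws (Birkhoff); G belongs to it
  iff G is a group satisfying every law in L.\<close>
definition in_variety :: "word set \<Rightarrow> ('g, 'b) monoid_scheme \<Rightarrow> bool" where
  "in_variety L G \<longleftrightarrow> group G \<and> (\<forall>w\<in>L. satisfies_law G w)"

definition in_product :: "word set \<Rightarrow> word set \<Rightarrow> 'g monoid \<Rightarrow> bool" where
  "in_product LU LV G \<longleftrightarrow> group G \<and>
     (\<exists>N. N \<lhd> G \<and> in_variety LU (G\<lparr>carrier := N\<rparr>) \<and> in_variety LV (G Mod N))"

inductive freeq :: "word \<Rightarrow> word \<Rightarrow> bool" where
  refl: "freeq u u"
| sym: "freeq u v \<Longrightarrow> freeq v u"
| trans: "freeq u v \<Longrightarrow> freeq v w \<Longrightarrow> freeq u w"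
| cancel: "freeq (u @ [(b, i), (\<not> b, i)] @ v) (u @ v)"

definition free_group :: "word set monoid" where
  "free_group =
     \<lparr>carrier = range (\<lambda>w. Collect (freeq w)),
      mult = (\<lambda>A B. Collect (freeq ((SOME a. a \<in> A) @ (SOME b. b \<in> B)))),
      one = Collect (freeq [])\<rparr>"

text \<open>Relatively free group of countably infinite rank of a class K of groups:
  F / R where R is the intersection of all normal subgroups N of the free group F
  with F/N in K.  For a variety K this is F_infinity(K).\<close>
definition rel_free :: "(word set set monoid \<Rightarrow> bool) \<Rightarrow> word set set monoid" where
  "rel_free K = free_group Mod (\<Inter>{N. N \<lhd> free_group \<and> K (free_group Mod N)})"

definition m_generated :: "('g, 'b) monoid_scheme \<Rightarrow> nat \<Rightarrow> bool" where
  "m_generated G m \<longleftrightarrow>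
     (\<exists>xs. length xs = m \<and> set xs \<subseteq> carrier G \<and> generate G (set xs) = carrier G)"

definition discriminates :: "('d, 'b) monoid_scheme \<Rightarrow> ('f, 'c) monoid_scheme \<Rightarrow> bool" where
  "discriminates D F \<longleftrightarrow>
     (\<forall>S. finite S \<and> S \<subseteq> carrier F \<longrightarrow> (\<exists>h \<in> hom F D. inj_on h S))"

end

theory Submission
  imports Defs
begin

text \<open>
  Write G as the quotient of the free group F on m generators by N. The m-generated group that
  discriminates is F / U(N), described here through labellings: a word dies in it iff it is trivial
  in G and its label product vanishes for every labelling of the edges of the Cayley graph of G by
  elements of a group in U.

  Let finitely many words w be nontrivial in the UV-free group. A homomorphism to D that is injective
  on all their prefixes sends the i-th variable to some b(i), and any lift of the b(i) to F separates
  the words that are nontrivial in the V-free group. If some w is trivial there, then V has a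
  nontrivial law, hence a reduced law u in two variables. In the infinite coset graph of D, copies of
  the closed walk u occur arbitrarily far away, and each contains an edge that is not a bridge; so one
  finds private edges e(1), ..., e(n), away from the walks of generators of D, whose joint removal
  leaves the graph connected. Hence b(i) lifts to a word whose walk crosses e(i) exactly once and no
  other e(j). Labelling the lift at d of e(i) by T(d) q(i) / T(d b(i)), where q is a valuation in a
  UV-group with w nontrivial and T(d) is the value of the prefix of w that reaches d, makes the label
  product along w telescope to a conjugate of the value of w.
\<close>

section \<open>Words and the free group\<close>

text \<open>N is the fundamental group of the Cayley graph of G, free on the edges outside a
  spanning tree, so every homomorphism from N to a group of U is an edge labelling restricted to
  closed walks. Quantifying over labellings thus describes U(N) without a basis of N.

  The obstacle is that the b(i) may satisfy relations in D, while the labels must react to w as if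
  its variables were independent. A private edge per variable, crossed once, lets the label read at
  each d in D along each b(i) be prescribed at will.

  The number of private edges grows with the given words, hence the infinite index. Finite
  generation of D confines the walks that correct an endpoint inside D to finitely many edges, which
  the private edges avoid. The law supplies cycles far out in the coset graph; having two variables,
  it puts the private edges on two of the m generators.

  Injectivity on prefixes is what puts the labels in a group of U: prefixes that meet at d agree in
  the V-free group, so T(d) is the q-value of each of them modulo the normal subgroup in U, and T(d)
  q(i) / T(d b(i)) lies in that subgroup.\<close>

definition flip_letter :: "bool \<times> nat \<Rightarrow> bool \<times> nat" where
  "flip_letter l = (\<not> fst l, snd l)"

definition inv_word :: "word \<Rightarrow> word" where
  "inv_word w = map flip_letter (rev w)"

definition subst_word :: "(nat \<Rightarrow> word) \<Rightarrow> word \<Rightarrow> word" where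
  "subst_word s w = concat (map (\<lambda>(b, i). if b then s i else inv_word (s i)) w)"

definition eval_letter :: "('g, 'b) monoid_scheme \<Rightarrow> (nat \<Rightarrow> 'g) \<Rightarrow> bool \<times> nat \<Rightarrow> 'g" where
  "eval_letter G a l = (if fst l then a (snd l) else inv\<^bsub>G\<^esub> a (snd l))"

lemma flip_letter_simps [simp]:
  "flip_letter (b, i) = (\<not> b, i)" "flip_letter (flip_letter l) = l" "snd (flip_letter l) = snd l"
  by (auto simp: flip_letter_def)

lemma inv_word_simps [simp]:
  "inv_word [] = []"
  "inv_word (u @ v) = inv_word v @ inv_word u"
  "inv_word (l # u) = inv_word u @ [flip_letter l]"
  "inv_word (inv_word u) = u"
  by (auto simp: inv_word_def rev_map o_def)

lemma subst_word_simps [simp]: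
  "subst_word s [] = []"
  "subst_word s (u @ v) = subst_word s u @ subst_word s v"
  "subst_word s ((b, i) # u) = (if b then s i else inv_word (s i)) @ subst_word s u"
  by (auto simp: subst_word_def)

lemma subst_word_inv_word: "subst_word s (inv_word u) = inv_word (subst_word s u)"
  by (induction u) auto

lemma eval_word_Nil [simp]: "eval_word G a [] = \<one>\<^bsub>G\<^esub>"
  by (simp add: eval_word_def)

lemma eval_word_Cons [simp]: "eval_word G a (l # w) = eval_letter G a l \<otimes>\<^bsub>G\<^esub> eval_word G a w"
  by (cases l) (simp add: eval_word_def eval_letter_def)

context group
begin

lemma eval_letter_closed [simp]: "range a \<subseteq> carrier G \<Longrightarrow> eval_letter G a l \<in> carrier G"
  by (auto simp: eval_letter_def)

lemma eval_letter_flip: "range a \<subseteq> carrier G \<Longrightarrow> eval_letter G a (flip_letter l) = inv eval_letter G a l"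
  by (auto simp: eval_letter_def flip_letter_def image_subset_iff)

lemma eval_word_closed [simp]: "range a \<subseteq> carrier G \<Longrightarrow> eval_word G a w \<in> carrier G"
  by (induction w) auto

lemma eval_word_append:
  "range a \<subseteq> carrier G \<Longrightarrow> eval_word G a (u @ v) = eval_word G a u \<otimes> eval_word G a v"
  by (induction u) (auto simp: m_assoc)

lemma eval_word_inv_word:
  "range a \<subseteq> carrier G \<Longrightarrow> eval_word G a (inv_word w) = inv eval_word G a w"
  by (induction w) (auto simp: eval_word_append eval_letter_flip inv_mult_group)

lemma eval_word_subst:
  "range a \<subseteq> carrier G \<Longrightarrow>
     eval_word G a (subst_word s w) = eval_word G (\<lambda>i. eval_word G a (s i)) w"
  by (induction w) (auto simp: eval_word_append eval_word_inv_word eval_letter_def)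

lemma eval_word_freeq:
  assumes "freeq u v" "range a \<subseteq> carrier G"
  shows "eval_word G a u = eval_word G a v"
  using assms(1)
proof (induction rule: freeq.induct)
  case (cancel u b i v)
  have "a i \<in> carrier G" using assms(2) by auto
  then have "a i \<otimes> (inv a i \<otimes> x) = x" "inv a i \<otimes> (a i \<otimes> x) = x" if "x \<in> carrier G" for x
    using that by (simp_all add: m_assoc[symmetric])
  then show ?case
    using assms(2) by (simp add: eval_word_append eval_letter_def m_assoc)
qed auto

lemma eval_word_subgroup:
  assumes "subgroup H G" "range a \<subseteq> H"
  shows "eval_word (G\<lparr>carrier := H\<rparr>) a w = eval_word G a w"
proof -
  have "a i \<in> H" for i using assms(2) by auto
  then show ?thesis
    using assms(1) by (induction w) (auto simp: eval_letter_def)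
qed

lemma eval_word_in_subgroup:
  assumes "subgroup H G" "range a \<subseteq> H"
  shows "eval_word G a w \<in> H"
  using group.eval_word_closed[OF subgroup_imp_group[OF assms(1)], of a w] assms
  by (simp add: eval_word_subgroup)

lemma exists_word_generate:
  assumes "range a \<subseteq> carrier G" "g \<in> generate G (range a)"
  shows "\<exists>w. eval_word G a w = g"
  using assms(2)
proof (induction rule: generate.induct)
  case one
  show ?case by (rule exI[of _ "[]"]) simp
next
  case (incl h)
  then obtain i where "h = a i" by auto
  then show ?case
    using assms(1) by (intro exI[of _ "[(True, i)]"]) (auto simp: eval_letter_def image_subset_iff)
next
  case (inv h)
  then obtain i where "h = a i" by auto
  then show ?case
    using assms(1) by (intro exI[of _ "[(False, i)]"]) (auto simp: eval_letter_def image_subset_iff)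
next
  case (eng h1 h2)
  then show ?case using eval_word_append[OF assms(1)] by metis
qed

end

lemma (in group_hom) hom_eval_word:
  assumes "range a \<subseteq> carrier G"
  shows "h (eval_word G a w) = eval_word H (\<lambda>i. h (a i)) w"
proof -
  have a: "a i \<in> carrier G" for i using assms by auto
  have "h (eval_letter G a l) = eval_letter H (\<lambda>i. h (a i)) l" for l
    using a by (auto simp: eval_letter_def)
  then show ?thesis
    using assms by (induction w) auto
qed

section \<open>The free group of word classes and its universal property\<close>

abbreviation word_class :: "word \<Rightarrow> word set" where
  "word_class w \<equiv> Collect (freeq w)"

lemma word_class_eq_iff: "word_class u = word_class v \<longleftrightarrow> freeq u v"
  by (auto intro: freeq.refl freeq.sym freeq.trans)

lemma freeq_append_context: "freeq u v \<Longrightarrow> freeq (p @ u @ q) (p @ v @ q)"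
proof (induction rule: freeq.induct)
  case (cancel u b i v)
  then show ?case using freeq.cancel[of "p @ u" b i "v @ q"] by simp
qed (auto intro: freeq.intros)

lemma freeq_append: "freeq u u' \<Longrightarrow> freeq v v' \<Longrightarrow> freeq (u @ v) (u' @ v')"
  using freeq_append_context[of u u' "[]" v] freeq_append_context[of v v' u' "[]"]
  by (auto intro: freeq.trans)

lemma freeq_inv_word: "freeq (inv_word w @ w) []"
proof (induction w)
  case (Cons l w)
  have "freeq (inv_word w @ [flip_letter l, l] @ w) (inv_word w @ w)"
    using freeq.cancel[of "inv_word w" "\<not> fst l" "snd l" w] by (simp add: flip_letter_def)
  then show ?case using Cons by (auto intro: freeq.trans)
qed (auto intro: freeq.refl)

text \<open>\<open>free_group\<close> multiplies chosen representatives; together with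
  \<open>freeq_append\<close> this makes the product independent of the choice.\<close>

lemma freeq_some: "freeq (SOME u. u \<in> word_class w) w"
  by (metis freeq.refl freeq.sym mem_Collect_eq someI_ex)

lemma free_group_mult [simp]:
  "word_class u \<otimes>\<^bsub>free_group\<^esub> word_class v = word_class (u @ v)"
  using freeq_append[OF freeq_some freeq_some] by (simp add: free_group_def word_class_eq_iff)

lemma free_group_one: "\<one>\<^bsub>free_group\<^esub> = word_class []"
  by (simp add: free_group_def)

lemma free_group_carrier: "carrier free_group = range word_class"
  by (simp add: free_group_def)

lemma word_class_in_carrier [simp]: "word_class u \<in> carrier free_group"
  by (simp add: free_group_carrier)

lemma free_groupE:
  assumes "A \<in> carrier free_group"
  obtains u where "A = word_class u"
  using assms by (auto simp: free_group_carrier)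

lemma group_free_group: "group free_group"
proof (rule groupI)
  fix A assume "A \<in> carrier free_group"
  then obtain w where "A = word_class w" by (rule free_groupE)
  then have "word_class (inv_word w) \<otimes>\<^bsub>free_group\<^esub> A = \<one>\<^bsub>free_group\<^esub>"
    using freeq_inv_word by (simp add: word_class_eq_iff free_group_one)
  then show "\<exists>B\<in>carrier free_group. B \<otimes>\<^bsub>free_group\<^esub> A = \<one>\<^bsub>free_group\<^esub>"
    using word_class_in_carrier by blast
qed (auto simp: free_group_one elim!: free_groupE)

interpretation free_group: group free_group
  by (rule group_free_group)

lemma free_group_inv [simp]: "inv\<^bsub>free_group\<^esub> word_class u = word_class (inv_word u)"
  by (rule free_group.inv_equality)
    (use freeq_inv_word in \<open>simp_all add: word_class_eq_iff free_group_one\<close>)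

lemma eval_word_free_group:
  "eval_word free_group (\<lambda>i. word_class (s i)) w = word_class (subst_word s w)"
  by (induction w) (auto simp: free_group_one eval_letter_def)

lemma subst_word_letters: "subst_word (\<lambda>i. [(True, i)]) w = w"
  by (induction w) auto

definition free_ext :: "('g, 'b) monoid_scheme \<Rightarrow> (nat \<Rightarrow> 'g) \<Rightarrow> word set \<Rightarrow> 'g" where
  "free_ext G a A = eval_word G a (SOME u. u \<in> A)"

context group
begin

lemma free_ext_word_class [simp]:
  "range a \<subseteq> carrier G \<Longrightarrow> free_ext G a (word_class w) = eval_word G a w"
  unfolding free_ext_def by (intro eval_word_freeq freeq_some)

lemma group_hom_free_ext: "range a \<subseteq> carrier G \<Longrightarrow> group_hom free_group G (free_ext G a)"
  by unfold_locales (auto simp: hom_def eval_word_append elim!: free_groupE)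

end

section \<open>Varieties and relatively free groups\<close>

lemma eval_word_FactGroup:
  fixes q :: "nat \<Rightarrow> 'g"
  assumes "N \<lhd> Q" "range q \<subseteq> carrier Q"
  shows "eval_word (Q Mod N) (\<lambda>i. N #>\<^bsub>Q\<^esub> q i) w = N #>\<^bsub>Q\<^esub> eval_word Q q w"
proof -
  interpret N: normal N Q by fact
  interpret h: group_hom Q "Q Mod N" "\<lambda>x. N #>\<^bsub>Q\<^esub> x"
    using N.r_coset_hom_Mod N.factorgroup_is_group N.group_axioms
    by (simp add: group_hom_def group_hom_axioms_def)
  show ?thesis using h.hom_eval_word[OF assms(2)] by simp
qed

lemma (in normal) r_coset_eq_one_iff: "x \<in> carrier G \<Longrightarrow> H #> x = H \<longleftrightarrow> x \<in> H"
  using coset_join1[of H x] coset_join2[of x H] subgroup_axioms by blast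

text \<open>Evaluation commutes with the projection and every valuation in the quotient lifts to Q.
  Conditions on a quotient thus become conditions on values of words in Q itself, the form used from
  here on.\<close>

lemma in_variety_FactGroup_iff:
  assumes "N \<lhd> Q"
  shows "in_variety L (Q Mod N) \<longleftrightarrow>
    (\<forall>w\<in>L. \<forall>q::nat \<Rightarrow> _. range q \<subseteq> carrier Q \<longrightarrow> eval_word Q q w \<in> N)"
proof -
  interpret N: normal N Q by fact
  have *: "(\<forall>w\<in>L. \<forall>q::nat \<Rightarrow> _. range q \<subseteq> carrier Q \<longrightarrow> eval_word Q q w \<in> N)" if "in_variety L (Q Mod N)"
  proof safe
    fix w and q :: "nat \<Rightarrow> _" assume "w \<in> L" "range q \<subseteq> carrier Q"
    moreover have "\<forall>i. N #>\<^bsub>Q\<^esub> q i \<in> carrier (Q Mod N)"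
      using \<open>range q \<subseteq> carrier Q\<close> by (auto simp: carrier_FactGroup)
    ultimately have "eval_word (Q Mod N) (\<lambda>i. N #>\<^bsub>Q\<^esub> q i) w = N"
      using that by (auto simp: in_variety_def satisfies_law_def)
    then show "eval_word Q q w \<in> N"
      using eval_word_FactGroup[OF assms] N.r_coset_eq_one_iff \<open>range q \<subseteq> carrier Q\<close> by simp
  qed
  have "eval_word (Q Mod N) a w = N"
    if L: "\<forall>w\<in>L. \<forall>q::nat \<Rightarrow> _. range q \<subseteq> carrier Q \<longrightarrow> eval_word Q q w \<in> N"
      and "w \<in> L" "\<forall>i. a i \<in> carrier (Q Mod N)" for a w
  proof -
    have "\<forall>i. \<exists>x\<in>carrier Q. a i = N #>\<^bsub>Q\<^esub> x"
      using that(3) by (auto simp: carrier_FactGroup)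
    then obtain q where q: "\<And>i. q i \<in> carrier Q" "a = (\<lambda>i. N #>\<^bsub>Q\<^esub> q i)"
      by metis
    then have "range q \<subseteq> carrier Q" by auto
    then show ?thesis
      using q(2) L \<open>w \<in> L\<close> eval_word_FactGroup[OF assms] N.r_coset_eq_one_iff by simp
  qed
  then show ?thesis
    using * N.factorgroup_is_group by (auto simp: in_variety_def satisfies_law_def)
qed

lemma (in group) in_variety_subgroup_iff:
  assumes "subgroup N G"
  shows "in_variety L (G\<lparr>carrier := N\<rparr>) \<longleftrightarrow>
    (\<forall>w\<in>L. \<forall>a. range a \<subseteq> N \<longrightarrow> eval_word G a w = \<one>)"
  using subgroup_imp_group[OF assms]
  by (simp add: in_variety_def satisfies_law_def image_subset_iff eval_word_subgroup[OF assms]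
      cong: imp_cong)

lemma in_product_iff:
  "in_product LU LV G \<longleftrightarrow> group G \<and> (\<exists>N. N \<lhd> G \<and>
     (\<forall>w\<in>LU. \<forall>a. range a \<subseteq> N \<longrightarrow> eval_word G a w = \<one>\<^bsub>G\<^esub>) \<and>
     (\<forall>w\<in>LV. \<forall>a. range a \<subseteq> carrier G \<longrightarrow> eval_word G a w \<in> N))"
  unfolding in_product_def
  by (intro conj_cong refl ex_cong1)
    (simp_all add: group.in_variety_subgroup_iff in_variety_FactGroup_iff normal_imp_subgroup)

text \<open>Varieties are closed under subgroups. The form with an embedding allows the subgroup to
  be a quotient of the free group, of another type than B.\<close>

lemma in_variety_inj_hom:
  assumes "group_hom A B h" "inj_on h (carrier A)" "in_variety L B"
  shows "in_variety L A"
proof -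
  interpret h: group_hom A B h by fact
  have "eval_word A a w = \<one>\<^bsub>A\<^esub>" if "w \<in> L" and a: "range a \<subseteq> carrier A" for w a
  proof -
    have "\<forall>i. h (a i) \<in> carrier B" using a by (simp add: image_subset_iff)
    then have "h (eval_word A a w) = h \<one>\<^bsub>A\<^esub>"
      using assms(3) \<open>w \<in> L\<close> h.hom_eval_word[OF a] by (auto simp: in_variety_def satisfies_law_def)
    then show ?thesis using inj_onD[OF assms(2)] a by simp
  qed
  then show ?thesis
    using h.G.group_axioms by (auto simp: in_variety_def satisfies_law_def image_subset_iff)
qed

text \<open>The preimage of the normal subgroup of B serves for A: its valuations map into N, where
  the laws of U hold, and values of the laws of V map into N.\<close>

lemma in_product_inj_hom:
  assumes "group_hom A B h" "inj_on h (carrier A)" "in_product LU LV B"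
  shows "in_product LU LV A"
proof -
  interpret h: group_hom A B h by fact
  obtain N where N: "N \<lhd> B"
    and LU: "\<And>w b. w \<in> LU \<Longrightarrow> range b \<subseteq> N \<Longrightarrow> eval_word B b w = \<one>\<^bsub>B\<^esub>"
    and LV: "\<And>w b. w \<in> LV \<Longrightarrow> range b \<subseteq> carrier B \<Longrightarrow> eval_word B b w \<in> N"
    using assms(3) unfolding in_product_iff by blast
  interpret N: normal N B by fact
  define N' where "N' = {x \<in> carrier A. h x \<in> N}"
  have "subgroup N' A"
    by (rule h.G.subgroupI) (auto simp: N'_def)
  moreover have "x \<otimes>\<^bsub>A\<^esub> y \<otimes>\<^bsub>A\<^esub> inv\<^bsub>A\<^esub> x \<in> N'" if "x \<in> carrier A" "y \<in> N'" for x y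
    using that N.inv_op_closed2 by (auto simp: N'_def)
  ultimately have "N' \<lhd> A" by (rule h.G.normal_invI)
  moreover have "eval_word A a w = \<one>\<^bsub>A\<^esub>" if "w \<in> LU" "range a \<subseteq> N'" for w a
  proof -
    have a: "range a \<subseteq> carrier A" "range (\<lambda>i. h (a i)) \<subseteq> N"
      using that(2) by (auto simp: N'_def)
    then have "h (eval_word A a w) = h \<one>\<^bsub>A\<^esub>"
      using LU[OF \<open>w \<in> LU\<close>] h.hom_eval_word by simp
    then show ?thesis using inj_onD[OF assms(2)] a by simp
  qed
  moreover have "eval_word A a w \<in> N'" if "w \<in> LV" "range a \<subseteq> carrier A" for w a
  proof -
    have "range (\<lambda>i. h (a i)) \<subseteq> carrier B" using that(2) by auto
    then show ?thesis
      using that LV[of w "\<lambda>i. h (a i)"] h.hom_eval_word[of a w] by (simp add: N'_def)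
  qed
  ultimately show ?thesis
    using h.G.group_axioms unfolding in_product_iff by blast
qed

section \<open>Relatively free groups and their kernels\<close>

definition rel_free_kernel :: "(word set set monoid \<Rightarrow> bool) \<Rightarrow> word set set" where
  "rel_free_kernel P = \<Inter>{N. N \<lhd> free_group \<and> P (free_group Mod N)}"

lemma rel_free_eq: "rel_free P = free_group Mod rel_free_kernel P"
  by (simp add: rel_free_def rel_free_kernel_def)

lemma in_product_trivial:
  fixes G (structure)
  assumes "group G" "carrier G = {\<one>}"
  shows "in_product LU LV G"
proof -
  interpret group G by fact
  have "eval_word G a w = \<one>" if "range a \<subseteq> carrier G" for a w
    using eval_word_closed[OF that] assms(2) by auto
  moreover have "carrier G \<lhd> G"
    using normal_invI subgroup_self by auto
  ultimately show ?thesis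
    unfolding in_product_iff using eval_word_closed group_axioms by blast
qed

lemma (in group) normal_Inter:
  assumes "\<And>N. N \<in> \<N> \<Longrightarrow> N \<lhd> G" "\<N> \<noteq> {}"
  shows "\<Inter>\<N> \<lhd> G"
proof (rule normal_invI)
  show "subgroup (\<Inter>\<N>) G"
    using assms by (intro subgroups_Inter) (auto intro: normal_imp_subgroup)
  show "x \<otimes> h \<otimes> inv x \<in> \<Inter>\<N>" if "x \<in> carrier G" "h \<in> \<Inter>\<N>" for x h
    using that assms(1) normal.inv_op_closed2 by fastforce
qed

lemma kernel_quotient_embeds:
  assumes "group_hom A B h"
  shows "\<exists>f. group_hom (A Mod kernel A B h) B f \<and> inj_on f (carrier (A Mod kernel A B h))"
proof -
  interpret h: group_hom A B h by fact
  have "group_hom (A Mod kernel A B h) B (\<lambda>X. the_elem (h ` X))"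
    using h.FactGroup_hom normal.factorgroup_is_group[OF h.normal_kernel]
    by (simp add: group_hom_axioms_def group_hom_def)
  then show ?thesis using h.FactGroup_inj_on by blast
qed

lemma (in normal) r_coset_eq_iff:
  "x \<in> carrier G \<Longrightarrow> y \<in> carrier G \<Longrightarrow> H #> x = H #> y \<longleftrightarrow> x \<otimes> inv y \<in> H"
  by (metis coset_mult_inv1 coset_mult_inv2 inv_closed m_closed r_coset_eq_one_iff subset)

lemma word_class_coset_eq_iff:
  assumes "N \<lhd> free_group"
  shows "N #>\<^bsub>free_group\<^esub> word_class u = N #>\<^bsub>free_group\<^esub> word_class v
    \<longleftrightarrow> word_class (u @ inv_word v) \<in> N"
  using normal.r_coset_eq_iff[OF assms] by simp

lemma eval_word_free_quotient:
  assumes "N \<lhd> free_group"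
  shows "eval_word (free_group Mod N) (\<lambda>i. N #>\<^bsub>free_group\<^esub> word_class (s i)) w
    = N #>\<^bsub>free_group\<^esub> word_class (subst_word s w)"
  using eval_word_FactGroup[OF assms, of "\<lambda>i. word_class (s i)"]
  by (simp add: eval_word_free_group image_subset_iff)

lemma free_quotientE:
  assumes "X \<in> carrier (free_group Mod N)"
  obtains u where "X = N #>\<^bsub>free_group\<^esub> word_class u"
  using assms by (auto simp: carrier_FactGroup elim!: free_groupE)

text \<open>The kernel of the valuation \<open>a\<close> is one of the normal subgroups that are
  intersected. The property P is asked of its quotient only; for varieties and products it is
  inherited from X, into which this quotient embeds.\<close>

lemma rel_free_kernel_eval:
  assumes "group X" "range a \<subseteq> carrier X"
    and "P (free_group Mod kernel free_group X (free_ext X a))"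
    and "word_class w \<in> rel_free_kernel P"
  shows "eval_word X a w = \<one>\<^bsub>X\<^esub>"
proof -
  interpret X: group X by fact
  interpret h: group_hom free_group X "free_ext X a"
    using assms(2) by (rule X.group_hom_free_ext)
  have "word_class w \<in> kernel free_group X (free_ext X a)"
    using assms(3,4) h.normal_kernel unfolding rel_free_kernel_def by blast
  then show ?thesis using assms(2) by (simp add: kernel_def)
qed

lemma in_variety_rel_free_kernel_eval:
  assumes "in_variety L X" "range a \<subseteq> carrier X"
    and "word_class w \<in> rel_free_kernel (in_variety L)"
  shows "eval_word X a w = \<one>\<^bsub>X\<^esub>"
proof -
  have "group X" using assms(1) by (simp add: in_variety_def)
  moreover from this have "group_hom free_group X (free_ext X a)"
    using assms(2) by (rule group.group_hom_free_ext)
  then obtain f where "group_hom (free_group Mod kernel free_group X (free_ext X a)) X f"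
    "inj_on f (carrier (free_group Mod kernel free_group X (free_ext X a)))"
    using kernel_quotient_embeds by blast
  ultimately show ?thesis
    using in_variety_inj_hom assms by (intro rel_free_kernel_eval) blast+
qed

lemma in_product_rel_free_kernel_eval:
  assumes "in_product LU LV X" "range a \<subseteq> carrier X"
    and "word_class w \<in> rel_free_kernel (in_product LU LV)"
  shows "eval_word X a w = \<one>\<^bsub>X\<^esub>"
proof -
  have "group X" using assms(1) by (simp add: in_product_def)
  moreover from this have "group_hom free_group X (free_ext X a)"
    using assms(2) by (rule group.group_hom_free_ext)
  then obtain f where "group_hom (free_group Mod kernel free_group X (free_ext X a)) X f"
    "inj_on f (carrier (free_group Mod kernel free_group X (free_ext X a)))"
    using kernel_quotient_embeds by blast
  ultimately show ?thesis
    using in_product_inj_hom assms by (intro rel_free_kernel_eval) blast+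
qed

text \<open>A word outside the intersection misses some N, and the quotient by N with the classes of
  the variables is the witness. Its type is the one over which the labelling groups will
  range.\<close>

lemma not_in_rel_free_kernelE:
  assumes "word_class w \<notin> rel_free_kernel P"
  obtains Q q where "group Q" "P Q" "range q \<subseteq> carrier Q" "eval_word Q q w \<noteq> \<one>\<^bsub>Q\<^esub>"
proof -
  obtain N where N: "N \<lhd> free_group" "P (free_group Mod N)" "word_class w \<notin> N"
    using assms unfolding rel_free_kernel_def by blast
  have "eval_word (free_group Mod N) (\<lambda>i. N #>\<^bsub>free_group\<^esub> word_class [(True, i)]) w \<noteq> N"
    using N(3) normal.r_coset_eq_one_iff[OF N(1)]
    by (simp add: eval_word_free_quotient[OF N(1)] subst_word_letters)
  moreover have "range (\<lambda>i. N #>\<^bsub>free_group\<^esub> word_class [(True, i)]) \<subseteq> carrier (free_group Mod N)"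
    by (auto simp: carrier_FactGroup)
  ultimately show ?thesis
    using that N(2) normal.factorgroup_is_group[OF N(1)] by (metis one_FactGroup)
qed

text \<open>The hypothesis, which says that the trivial group has property P, keeps the family
  nonempty; an empty intersection would be \<open>UNIV\<close>, not a subgroup of the free
  group.\<close>

lemma normal_rel_free_kernel:
  assumes "P (free_group Mod carrier free_group)"
  shows "rel_free_kernel P \<lhd> free_group"
  unfolding rel_free_kernel_def
proof (rule free_group.normal_Inter)
  have "carrier free_group \<lhd> free_group"
    using free_group.normal_invI free_group.subgroup_self by auto
  then show "{N. N \<lhd> free_group \<and> P (free_group Mod N)} \<noteq> {}"
    using assms by blast
qed auto

lemma normal_rel_free_kernel_variety: "rel_free_kernel (in_variety L) \<lhd> free_group"
proof (rule normal_rel_free_kernel)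
  have "carrier free_group \<lhd> free_group"
    using free_group.normal_invI free_group.subgroup_self by auto
  then show "in_variety L (free_group Mod carrier free_group)"
    by (simp add: in_variety_FactGroup_iff)
qed

lemma normal_rel_free_kernel_product: "rel_free_kernel (in_product LU LV) \<lhd> free_group"
proof (rule normal_rel_free_kernel, rule in_product_trivial)
  have n: "carrier free_group \<lhd> free_group"
    using free_group.normal_invI free_group.subgroup_self by auto
  then show "group (free_group Mod carrier free_group)"
    by (rule normal.factorgroup_is_group)
  have "carrier free_group #>\<^bsub>free_group\<^esub> A = carrier free_group" if "A \<in> carrier free_group" for A
    using normal.r_coset_eq_one_iff[OF n that] that by simp
  then show "carrier (free_group Mod carrier free_group) = {\<one>\<^bsub>free_group Mod carrier free_group\<^esub>}"
    using word_class_in_carrier by (auto simp: carrier_FactGroup)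
qed

text \<open>Von Dyck's theorem: a valuation that kills the relators R factors through the quotient
  by R.\<close>

lemma free_quotient_hom:
  assumes "R \<lhd> free_group" "group X" "range a \<subseteq> carrier X"
    and "\<And>w. word_class w \<in> R \<Longrightarrow> eval_word X a w = \<one>\<^bsub>X\<^esub>"
  obtains h where "h \<in> hom (free_group Mod R) X"
    "\<And>u. h (R #>\<^bsub>free_group\<^esub> word_class u) = eval_word X a u"
proof -
  interpret X: group X by fact
  interpret f: group_hom free_group X "free_ext X a"
    using assms(3) by (rule X.group_hom_free_ext)
  have *: "eval_word X a u = eval_word X a v"
    if "R #>\<^bsub>free_group\<^esub> word_class u = R #>\<^bsub>free_group\<^esub> word_class v" for u v
  proof -
    have "eval_word X a (u @ inv_word v) = \<one>\<^bsub>X\<^esub>"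
      using that assms(4) by (simp add: word_class_coset_eq_iff[OF assms(1)])
    then have "inv\<^bsub>X\<^esub> (inv\<^bsub>X\<^esub> eval_word X a v) = eval_word X a u"
      using assms(3)
      by (intro X.inv_equality) (simp_all add: X.eval_word_append X.eval_word_inv_word)
    then show ?thesis using assms(3) by simp
  qed
  have key: "free_ext X a A = free_ext X a B"
    if AB: "A \<in> carrier free_group" "B \<in> carrier free_group"
      "R #>\<^bsub>free_group\<^esub> A = R #>\<^bsub>free_group\<^esub> B" for A B
  proof -
    obtain u v where "A = word_class u" "B = word_class v"
      using AB(1,2) free_groupE by metis
    then show ?thesis using *[of u v] AB(3) assms(3) by simp
  qed
  show thesis
  proof (rule FactGroup_universal[OF f.homh assms(1) key])
    fix h assume h: "h \<in> hom (free_group Mod R) X"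
      "\<And>A. A \<in> carrier free_group \<Longrightarrow> h (R #>\<^bsub>free_group\<^esub> A) = free_ext X a A"
    show thesis
      using h(2)[OF word_class_in_carrier] X.free_ext_word_class[OF assms(3)]
      by (intro that[OF h(1)]) simp
  qed
qed

section \<open>Edge labellings of Cayley graphs\<close>

text \<open>The inverse of x_i read at g runs backwards along the edge that starts at g a(i)^-1,
  hence the shifted base point and the inverted label.\<close>

definition edge_label ::
  "('q, 'c) monoid_scheme \<Rightarrow> ('g, 'b) monoid_scheme \<Rightarrow> (nat \<Rightarrow> 'g) \<Rightarrow> ('g \<Rightarrow> nat \<Rightarrow> 'q)
    \<Rightarrow> 'g \<Rightarrow> bool \<times> nat \<Rightarrow> 'q" where
  "edge_label M G a lam g l =
     (if fst l then lam g (snd l) else inv\<^bsub>M\<^esub> lam (g \<otimes>\<^bsub>G\<^esub> inv\<^bsub>G\<^esub> a (snd l)) (snd l))"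

text \<open>The edge of the Cayley graph from g to g a(i) carries the label lam g i; a word, read as a walk
  starting at g, gets the product of the labels along the walk.\<close>

fun path_label ::
  "('q, 'c) monoid_scheme \<Rightarrow> ('g, 'b) monoid_scheme \<Rightarrow> (nat \<Rightarrow> 'g) \<Rightarrow> ('g \<Rightarrow> nat \<Rightarrow> 'q)
    \<Rightarrow> 'g \<Rightarrow> word \<Rightarrow> 'q" where
  "path_label M G a lam g [] = \<one>\<^bsub>M\<^esub>"
| "path_label M G a lam g (l # w) =
     edge_label M G a lam g l \<otimes>\<^bsub>M\<^esub> path_label M G a lam (g \<otimes>\<^bsub>G\<^esub> eval_letter G a l) w"

locale edge_labelling = G: group G + M: group M
  for G :: "('g, 'b) monoid_scheme" (structure) and M :: "('q, 'c) monoid_scheme" +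
  fixes a :: "nat \<Rightarrow> 'g" and lam :: "'g \<Rightarrow> nat \<Rightarrow> 'q"
  assumes a_closed [simp]: "a i \<in> carrier G"
    and lam_closed [simp]: "g \<in> carrier G \<Longrightarrow> lam g i \<in> carrier M"
begin

lemma range_a [simp]: "range a \<subseteq> carrier G"
  by auto

lemma edge_label_closed [simp]: "g \<in> carrier G \<Longrightarrow> edge_label M G a lam g l \<in> carrier M"
  by (simp add: edge_label_def)

lemma path_label_closed [simp]: "g \<in> carrier G \<Longrightarrow> path_label M G a lam g w \<in> carrier M"
  by (induction w arbitrary: g) auto

lemma path_label_append:
  "g \<in> carrier G \<Longrightarrow> path_label M G a lam g (u @ v) =
     path_label M G a lam g u \<otimes>\<^bsub>M\<^esub> path_label M G a lam (g \<otimes> eval_word G a u) v"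
  by (induction u arbitrary: g) (auto simp: M.m_assoc G.m_assoc)

lemma edge_label_flip:
  assumes "g \<in> carrier G"
  shows "edge_label M G a lam (g \<otimes> eval_letter G a l) (flip_letter l) =
    inv\<^bsub>M\<^esub> edge_label M G a lam g l"
  using assms by (auto simp: edge_label_def eval_letter_def flip_letter_def G.m_assoc)

lemma path_label_inv_word:
  "g \<in> carrier G \<Longrightarrow> path_label M G a lam (g \<otimes> eval_word G a u) (inv_word u) =
     inv\<^bsub>M\<^esub> path_label M G a lam g u"
proof (induction u arbitrary: g)
  case (Cons l u)
  have "g \<otimes> eval_word G a (l # u) \<otimes> eval_word G a (inv_word u) = g \<otimes> eval_letter G a l"
    using Cons.prems by (simp add: G.eval_word_inv_word G.m_assoc)
  then show ?case
    using Cons by (simp add: path_label_append G.m_assoc[symmetric] M.inv_mult_group edge_label_flip)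
qed simp

lemma path_label_freeq:
  assumes "freeq u v" "g \<in> carrier G"
  shows "path_label M G a lam g u = path_label M G a lam g v"
  using assms
proof (induction arbitrary: g rule: freeq.induct)
  case (cancel u b i v)
  let ?h = "g \<otimes> eval_word G a u" and ?l = "(b, i)"
  have "?h \<otimes> eval_letter G a ?l \<otimes> eval_letter G a (flip_letter ?l) = ?h"
    using cancel by (simp only: G.eval_letter_flip[OF range_a]) (simp add: G.m_assoc)
  moreover have "edge_label M G a lam ?h ?l \<otimes>\<^bsub>M\<^esub>
      (edge_label M G a lam (?h \<otimes> eval_letter G a ?l) (flip_letter ?l) \<otimes>\<^bsub>M\<^esub> x) = x"
    if "x \<in> carrier M" for x
    using cancel that by (subst edge_label_flip) (simp_all add: M.m_assoc[symmetric])
  ultimately show ?case using cancel by (simp add: path_label_append)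
qed auto

text \<open>Reading s(i) as one long edge from g to g b(i), where b(i) is its value, turns a
  labelling over \<open>a\<close> into one over \<open>b\<close>. This serves twice: with all b(i) =
  1 to verify the laws of U, and with b(i) in D to detect a word.\<close>

lemma path_label_subst:
  assumes "g \<in> carrier G"
  shows "path_label M G a lam g (subst_word s w) =
    path_label M G (\<lambda>i. eval_word G a (s i)) (\<lambda>g i. path_label M G a lam g (s i)) g w"
  using assms
proof (induction w arbitrary: g)
  case (Cons l w)
  obtain b i where l: "l = (b, i)" by (cases l)
  have "path_label M G a lam g (inv_word (s i)) =
      inv\<^bsub>M\<^esub> path_label M G a lam (g \<otimes> inv eval_word G a (s i)) (s i)"
    using path_label_inv_word[of "g \<otimes> inv eval_word G a (s i)" "s i"] Cons.prems
    by (simp add: G.m_assoc)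
  then show ?case
    using Cons by (simp add: l path_label_append edge_label_def eval_letter_def G.eval_word_inv_word)
qed simp

end

text \<open>All edges are loops, so the walk stays at g and its label is an ordinary value of w in
  M.\<close>

lemma path_label_at_one:
  assumes "group G" "g \<in> carrier G" "\<And>i. b i = \<one>\<^bsub>G\<^esub>"
  shows "path_label M G b lam g w = eval_word M (lam g) w"
proof -
  interpret group G by fact
  have "edge_label M G b lam g l = eval_letter M (lam g) l"
    "g \<otimes>\<^bsub>G\<^esub> eval_letter G b l = g" for l
    using assms(2,3) by (auto simp: edge_label_def eval_letter_def)
  then show ?thesis by (induction w) auto
qed

section \<open>The universal m-generated extension of G by a group of U\<close>

text \<open>M ranges over groups on the type of quotients of the free group;
  \<open>not_in_rel_free_kernelE\<close> finds its separating groups there. Trivial labels from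
  index m on make the variables beyond the first m die in the extension.\<close>

definition extension_labelling ::
  "word set \<Rightarrow> ('g, 'b) monoid_scheme \<Rightarrow> nat \<Rightarrow> word set set monoid \<Rightarrow>
    ('g \<Rightarrow> nat \<Rightarrow> word set set) \<Rightarrow> bool" where
  "extension_labelling LU G m M lam \<longleftrightarrow> in_variety LU M \<and>
     (\<forall>g\<in>carrier G. \<forall>i. lam g i \<in> carrier M \<and> (m \<le> i \<longrightarrow> lam g i = \<one>\<^bsub>M\<^esub>))"

text \<open>This is the kernel of a Magnus-type map into wreath products of M with G. Since every
  start g is allowed, invariance under conjugation only amounts to moving the start.\<close>

definition trivial_in_extensions ::
  "word set \<Rightarrow> ('g, 'b) monoid_scheme \<Rightarrow> (nat \<Rightarrow> 'g) \<Rightarrow> nat \<Rightarrow> word \<Rightarrow> bool" where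
  "trivial_in_extensions LU G a m u \<longleftrightarrow> eval_word G a u = \<one>\<^bsub>G\<^esub> \<and>
     (\<forall>M lam. \<forall>g\<in>carrier G.
        extension_labelling LU G m M lam \<longrightarrow> path_label M G a lam g u = \<one>\<^bsub>M\<^esub>)"

definition extension_kernel ::
  "word set \<Rightarrow> ('g, 'b) monoid_scheme \<Rightarrow> (nat \<Rightarrow> 'g) \<Rightarrow> nat \<Rightarrow> word set set" where
  "extension_kernel LU G a m = word_class ` Collect (trivial_in_extensions LU G a m)"

text \<open>Words have infinitely many variables, so the m generators are padded with 1.\<close>

locale generated_group = group G for G :: "('g, 'b) monoid_scheme" (structure) +
  fixes a :: "nat \<Rightarrow> 'g" and m :: nat
  assumes a_closed [simp]: "a i \<in> carrier G"
    and a_trivial: "m \<le> i \<Longrightarrow> a i = \<one>"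
begin

lemma range_a [simp]: "range a \<subseteq> carrier G"
  by auto

lemma edge_labelling_extension:
  "extension_labelling LU G m M lam \<Longrightarrow> edge_labelling G M a lam"
  using group_axioms
  by (simp add: extension_labelling_def edge_labelling_def edge_labelling_axioms_def in_variety_def)

lemma trivial_in_extensionsI:
  assumes "eval_word G a u = \<one>"
    and "\<And>M lam g. extension_labelling LU G m M lam \<Longrightarrow> edge_labelling G M a lam \<Longrightarrow>
      g \<in> carrier G \<Longrightarrow> path_label M G a lam g u = \<one>\<^bsub>M\<^esub>"
  shows "trivial_in_extensions LU G a m u"
  using assms edge_labelling_extension unfolding trivial_in_extensions_def by blast

lemma trivial_in_extensionsD:
  assumes "trivial_in_extensions LU G a m u"
  shows "eval_word G a u = \<one>"
    and "extension_labelling LU G m M lam \<Longrightarrow> g \<in> carrier G \<Longrightarrow> path_label M G a lam g u = \<one>\<^bsub>M\<^esub>"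
  using assms unfolding trivial_in_extensions_def by blast+

lemma trivial_in_extensions_freeq:
  assumes "freeq u v" "trivial_in_extensions LU G a m u"
  shows "trivial_in_extensions LU G a m v"
proof (rule trivial_in_extensionsI)
  show "eval_word G a v = \<one>"
    using trivial_in_extensionsD(1)[OF assms(2)] eval_word_freeq[OF assms(1) range_a] by simp
  fix M lam g
  assume *: "extension_labelling LU G m M lam" "edge_labelling G M a lam" "g \<in> carrier G"
  then show "path_label M G a lam g v = \<one>\<^bsub>M\<^esub>"
    using trivial_in_extensionsD(2)[OF assms(2) *(1,3)]
      edge_labelling.path_label_freeq[OF *(2) assms(1) *(3)] by simp
qed

lemma word_class_in_extension_kernel_iff:
  "word_class u \<in> extension_kernel LU G a m \<longleftrightarrow> trivial_in_extensions LU G a m u"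
proof
  assume "word_class u \<in> extension_kernel LU G a m"
  then obtain v where "freeq u v" "trivial_in_extensions LU G a m v"
    unfolding extension_kernel_def by (auto simp: word_class_eq_iff)
  then show "trivial_in_extensions LU G a m u"
    using trivial_in_extensions_freeq freeq.sym by blast
qed (auto simp: extension_kernel_def)

text \<open>A word with value 1 gives closed walks, so labels simply multiply and invert; in a
  conjugate by v, the labels along v and back cancel around a closed walk based at g v.\<close>

lemma normal_extension_kernel: "extension_kernel LU G a m \<lhd> free_group"
proof (rule free_group.normal_invI)
  show "subgroup (extension_kernel LU G a m) free_group"
  proof (rule free_group.subgroupI)
    have "trivial_in_extensions LU G a m []"
      by (simp add: trivial_in_extensions_def)
    then show "extension_kernel LU G a m \<noteq> {}"
      by (auto simp: extension_kernel_def)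
  next
    fix A assume A: "A \<in> extension_kernel LU G a m"
    then obtain u where u: "A = word_class u" "trivial_in_extensions LU G a m u"
      by (auto simp: extension_kernel_def)
    note u1 = trivial_in_extensionsD(1)[OF u(2)]
    have "trivial_in_extensions LU G a m (inv_word u)"
    proof (rule trivial_in_extensionsI)
      fix M lam g
      assume *: "extension_labelling LU G m M lam" "edge_labelling G M a lam" "g \<in> carrier G"
      then interpret edge_labelling G M a lam by simp
      show "path_label M G a lam g (inv_word u) = \<one>\<^bsub>M\<^esub>"
        using path_label_inv_word[OF *(3), of u] trivial_in_extensionsD(2)[OF u(2) *(1,3)] *(3)
        by (simp add: u1)
    qed (simp add: eval_word_inv_word u1)
    then show "inv\<^bsub>free_group\<^esub> A \<in> extension_kernel LU G a m"
      using u by (simp add: word_class_in_extension_kernel_iff)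
  next
    fix A B assume "A \<in> extension_kernel LU G a m" "B \<in> extension_kernel LU G a m"
    then obtain u v where uv: "A = word_class u" "trivial_in_extensions LU G a m u"
      "B = word_class v" "trivial_in_extensions LU G a m v"
      by (auto simp: extension_kernel_def)
    have "trivial_in_extensions LU G a m (u @ v)"
    proof (rule trivial_in_extensionsI)
      fix M lam g
      assume *: "extension_labelling LU G m M lam" "edge_labelling G M a lam" "g \<in> carrier G"
      then interpret edge_labelling G M a lam by simp
      show "path_label M G a lam g (u @ v) = \<one>\<^bsub>M\<^esub>"
        using *(3) trivial_in_extensionsD[OF uv(2)] trivial_in_extensionsD[OF uv(4)] *(1)
        by (simp add: path_label_append)
    qed (use trivial_in_extensionsD(1)[OF uv(2)] trivial_in_extensionsD(1)[OF uv(4)]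
        in \<open>simp add: eval_word_append\<close>)
    then show "A \<otimes>\<^bsub>free_group\<^esub> B \<in> extension_kernel LU G a m"
      using uv by (simp add: word_class_in_extension_kernel_iff)
  qed (auto simp: extension_kernel_def)
next
  fix A B assume A: "A \<in> carrier free_group" and "B \<in> extension_kernel LU G a m"
  then obtain u v where uv: "A = word_class v" "B = word_class u" "trivial_in_extensions LU G a m u"
    by (auto simp: extension_kernel_def elim!: free_groupE)
  note u1 = trivial_in_extensionsD(1)[OF uv(3)]
  have "trivial_in_extensions LU G a m (v @ u @ inv_word v)"
  proof (rule trivial_in_extensionsI)
    fix M lam g
    assume *: "extension_labelling LU G m M lam" "edge_labelling G M a lam" "g \<in> carrier G"
    then interpret edge_labelling G M a lam by simp
    show "path_label M G a lam g (v @ u @ inv_word v) = \<one>\<^bsub>M\<^esub>"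
      using path_label_inv_word[OF *(3), of v] trivial_in_extensionsD(2)[OF uv(3) *(1)] *(3)
      by (simp add: path_label_append u1)
  qed (simp add: eval_word_append eval_word_inv_word u1)
  then show "A \<otimes>\<^bsub>free_group\<^esub> B \<otimes>\<^bsub>free_group\<^esub> inv\<^bsub>free_group\<^esub> A \<in> extension_kernel LU G a m"
    using uv by (simp add: word_class_in_extension_kernel_iff)
qed

text \<open>The normal subgroup is the kernel of the map onto the values in G. Its elements come
  from words s(i) with value 1, so the label of w(s) at g is a value of w in M, trivial when w is a
  law of U.\<close>

lemma in_product_extension:
  assumes "in_variety LV G"
  shows "in_product LU LV (free_group Mod extension_kernel LU G a m)"
proof -
  let ?K = "extension_kernel LU G a m"
  let ?H = "free_group Mod ?K"
  note K = normal_extension_kernel[of LU]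
  have H: "group ?H" using K by (rule normal.factorgroup_is_group)
  obtain h where h: "h \<in> hom ?H G" "\<And>u. h (?K #>\<^bsub>free_group\<^esub> word_class u) = eval_word G a u"
    by (rule free_quotient_hom[OF K group_axioms range_a])
      (simp_all add: word_class_in_extension_kernel_iff trivial_in_extensions_def)
  interpret h: group_hom ?H G h
    using H h(1) group_axioms by (simp add: group_hom_def group_hom_axioms_def)
  have "eval_word ?H c w = \<one>\<^bsub>?H\<^esub>" if "w \<in> LU" "range c \<subseteq> kernel ?H G h" for w c
  proof -
    have "\<exists>u. c i = ?K #>\<^bsub>free_group\<^esub> word_class u \<and> eval_word G a u = \<one>" for i
    proof -
      have "c i \<in> carrier ?H" "h (c i) = \<one>" using that(2) by (auto simp: kernel_def)
      then show ?thesis using h(2) by (metis free_quotientE)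
    qed
    then obtain s where s: "\<And>i. c i = ?K #>\<^bsub>free_group\<^esub> word_class (s i)"
      "\<And>i. eval_word G a (s i) = \<one>"
      by metis
    have one: "eval_word G (\<lambda>i. \<one>) w = \<one>"
      by (induction w) (auto simp: eval_letter_def)
    have "trivial_in_extensions LU G a m (subst_word s w)"
    proof (rule trivial_in_extensionsI)
      fix M lam g
      assume *: "extension_labelling LU G m M lam" "edge_labelling G M a lam" "g \<in> carrier G"
      then interpret edge_labelling G M a lam by simp
      show "path_label M G a lam g (subst_word s w) = \<one>\<^bsub>M\<^esub>"
        using * \<open>w \<in> LU\<close>
        by (simp add: path_label_subst s(2) path_label_at_one[OF group_axioms]
            extension_labelling_def in_variety_def satisfies_law_def)
    qed (simp add: eval_word_subst s(2) one)
    then have "word_class (subst_word s w) \<in> ?K"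
      by (simp add: word_class_in_extension_kernel_iff)
    moreover have "c = (\<lambda>i. ?K #>\<^bsub>free_group\<^esub> word_class (s i))" using s(1) by auto
    ultimately show ?thesis
      using eval_word_free_quotient[OF K] normal.r_coset_eq_one_iff[OF K] by simp
  qed
  moreover have "eval_word ?H c w \<in> kernel ?H G h" if "w \<in> LV" "range c \<subseteq> carrier ?H" for w c
  proof -
    have "\<forall>i. h (c i) \<in> carrier G" using that(2) by (simp add: image_subset_iff)
    then show ?thesis
      using assms that h.hom_eval_word[OF that(2)] h.G.eval_word_closed[OF that(2)]
      by (simp add: kernel_def in_variety_def satisfies_law_def)
  qed
  ultimately show ?thesis
    unfolding in_product_iff using H h.normal_kernel by blast
qed

lemma m_generated_extension: "m_generated (free_group Mod extension_kernel LU G a m) m"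
proof -
  let ?K = "extension_kernel LU G a m"
  let ?H = "free_group Mod ?K"
  let ?x = "\<lambda>i. ?K #>\<^bsub>free_group\<^esub> word_class [(True, i)]"
  let ?xs = "map ?x [0..<m]"
  note K = normal_extension_kernel[of LU]
  interpret H: group ?H using K by (rule normal.factorgroup_is_group)
  have x: "range ?x \<subseteq> carrier ?H" by (auto simp: carrier_FactGroup)
  then have xs: "set ?xs \<subseteq> carrier ?H" by auto
  interpret E: subgroup "generate ?H (set ?xs)" ?H
    using xs by (rule H.generate_is_subgroup)
  have "?x i \<in> generate ?H (set ?xs)" for i
  proof (cases "i < m")
    case True
    then show ?thesis by (intro generate.incl) auto
  next
    case False
    \<comment> \<open>For i at least m the letter is a loop with trivial label at every
      vertex.\<close>
    have "trivial_in_extensions LU G a m [(True, i)]"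
    proof (rule trivial_in_extensionsI)
      fix M lam g
      assume *: "extension_labelling LU G m M lam" "edge_labelling G M a lam" "g \<in> carrier G"
      then interpret edge_labelling G M a lam by simp
      show "path_label M G a lam g [(True, i)] = \<one>\<^bsub>M\<^esub>"
        using * False by (simp add: edge_label_def extension_labelling_def)
    qed (use False in \<open>simp add: eval_letter_def a_trivial\<close>)
    then have "?x i = ?K"
      using normal.r_coset_eq_one_iff[OF K] by (simp add: word_class_in_extension_kernel_iff)
    then show ?thesis
      using E.one_closed by simp
  qed
  then have "eval_word ?H ?x u \<in> generate ?H (set ?xs)" for u
    by (intro H.eval_word_in_subgroup[OF E.subgroup_axioms]) auto
  then have "carrier ?H \<subseteq> generate ?H (set ?xs)"
    by (auto simp: eval_word_free_quotient[OF K] subst_word_letters elim!: free_quotientE)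
  then show ?thesis
    unfolding m_generated_def using xs E.subset by (intro exI[of _ ?xs]) auto
qed

end

section \<open>Schreier coset graphs\<close>

definition reduced :: "word \<Rightarrow> bool" where
  "reduced w \<longleftrightarrow> successively (\<lambda>l l'. l' \<noteq> flip_letter l) w"

text \<open>An edge is named by the coset of its tail and its generator, whichever way it is
  crossed: a letter and its inverse read back give the same edge.\<close>

definition letter_edge ::
  "('g, 'b) monoid_scheme \<Rightarrow> (nat \<Rightarrow> 'g) \<Rightarrow> 'g set \<Rightarrow> 'g \<Rightarrow> bool \<times> nat \<Rightarrow> 'g set \<times> nat" where
  "letter_edge G a D g l =
     (D #>\<^bsub>G\<^esub> (if fst l then g else g \<otimes>\<^bsub>G\<^esub> inv\<^bsub>G\<^esub> a (snd l)), snd l)"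

fun walk_edges ::
  "('g, 'b) monoid_scheme \<Rightarrow> (nat \<Rightarrow> 'g) \<Rightarrow> 'g set \<Rightarrow> 'g \<Rightarrow> word \<Rightarrow> ('g set \<times> nat) set" where
  "walk_edges G a D g [] = {}"
| "walk_edges G a D g (l # w) =
     insert (letter_edge G a D g l) (walk_edges G a D (g \<otimes>\<^bsub>G\<^esub> eval_letter G a l) w)"

section \<open>Coset graphs with edges removed, and edges that are not bridges\<close>

definition connected_avoiding ::
  "('g, 'b) monoid_scheme \<Rightarrow> (nat \<Rightarrow> 'g) \<Rightarrow> 'g set \<Rightarrow> ('g set \<times> nat) set \<Rightarrow> 'g \<Rightarrow> 'g \<Rightarrow> bool" where
  "connected_avoiding G a D B g h \<longleftrightarrow>
     (\<exists>q. walk_edges G a D g q \<inter> B = {} \<and> D #>\<^bsub>G\<^esub> (g \<otimes>\<^bsub>G\<^esub> eval_word G a q) = D #>\<^bsub>G\<^esub> h)"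

locale schreier_graph = group G for G :: "('g, 'b) monoid_scheme" (structure) +
  fixes a :: "nat \<Rightarrow> 'g" and D :: "'g set"
  assumes a_closed [simp]: "a i \<in> carrier G"
    and D_subgroup: "subgroup D G"
begin

sublocale D: subgroup D G
  by (rule D_subgroup)

lemma range_a [simp]: "range a \<subseteq> carrier G"
  by auto

lemma coset_mult_cong:
  assumes "D #> g = D #> h" "g \<in> carrier G" "h \<in> carrier G" "x \<in> carrier G"
  shows "D #> (g \<otimes> x) = D #> (h \<otimes> x)"
  using assms D.subset by (simp add: coset_mult_assoc[symmetric])

lemma coset_mult_cancel:
  assumes "D #> (g \<otimes> x) = D #> (h \<otimes> x)" "g \<in> carrier G" "h \<in> carrier G" "x \<in> carrier G"
  shows "D #> g = D #> h"
  using coset_mult_cong[OF assms(1), of "inv x"] assms by (simp add: m_assoc)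

lemma coset_left_mult: "d \<in> D \<Longrightarrow> g \<in> carrier G \<Longrightarrow> D #> (d \<otimes> g) = D #> g"
  using coset_join2[of d D] D.subset D_subgroup by (simp add: coset_mult_assoc[symmetric])

lemma letter_edge_cong:
  assumes "D #> g = D #> h" "g \<in> carrier G" "h \<in> carrier G"
  shows "letter_edge G a D g l = letter_edge G a D h l"
  using assms coset_mult_cong[OF assms, of "inv a (snd l)"] by (simp add: letter_edge_def)

lemma letter_edge_inj:
  assumes "letter_edge G a D g l = letter_edge G a D h l" "g \<in> carrier G" "h \<in> carrier G"
  shows "D #> g = D #> h"
  using assms coset_mult_cancel[of g "inv a (snd l)" h]
  by (auto simp: letter_edge_def split: if_splits)

lemma letter_edge_flip:
  "g \<in> carrier G \<Longrightarrow> letter_edge G a D (g \<otimes> eval_letter G a l) (flip_letter l) = letter_edge G a D g l"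
  by (auto simp: letter_edge_def eval_letter_def flip_letter_def m_assoc)

lemma walk_edges_append:
  "g \<in> carrier G \<Longrightarrow> walk_edges G a D g (u @ v) =
     walk_edges G a D g u \<union> walk_edges G a D (g \<otimes> eval_word G a u) v"
  by (induction u arbitrary: g) (auto simp: m_assoc)

lemma walk_edges_cong:
  "D #> g = D #> h \<Longrightarrow> g \<in> carrier G \<Longrightarrow> h \<in> carrier G \<Longrightarrow> walk_edges G a D g w = walk_edges G a D h w"
proof (induction w arbitrary: g h)
  case (Cons l w)
  show ?case
    using Cons.prems letter_edge_cong[of g h l] coset_mult_cong[of g h "eval_letter G a l"]
      Cons.IH[of "g \<otimes> eval_letter G a l" "h \<otimes> eval_letter G a l"] by simp
qed simp

lemma walk_edges_inv_word:
  "g \<in> carrier G \<Longrightarrow> walk_edges G a D (g \<otimes> eval_word G a u) (inv_word u) = walk_edges G a D g u"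
proof (induction u arbitrary: g)
  case (Cons l u)
  have "g \<otimes> eval_word G a (l # u) \<otimes> eval_word G a (inv_word u) = g \<otimes> eval_letter G a l"
    using Cons.prems by (simp add: eval_word_inv_word m_assoc)
  then show ?case
    using Cons by (simp add: walk_edges_append m_assoc[symmetric] letter_edge_flip)
qed simp

lemma in_walk_edgesE:
  assumes "e \<in> walk_edges G a D g u" "g \<in> carrier G"
  obtains r l s where "u = r @ l # s" "e = letter_edge G a D (g \<otimes> eval_word G a r) l"
proof -
  have "\<exists>r l s. u = r @ l # s \<and> e = letter_edge G a D (g \<otimes> eval_word G a r) l"
    using assms
  proof (induction u arbitrary: g)
    case (Cons l u)
    show ?case
    proof (cases "e = letter_edge G a D g l")
      case True
      then show ?thesis
        using Cons.prems by (intro exI[of _ "[]"] exI[of _ l] exI[of _ u]) simp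
    next
      case False
      then obtain r l' s where "u = r @ l' # s"
        "e = letter_edge G a D (g \<otimes> eval_letter G a l \<otimes> eval_word G a r) l'"
        using Cons.prems Cons.IH[of "g \<otimes> eval_letter G a l"] by auto
      then show ?thesis
        using Cons.prems
        by (intro exI[of _ "l # r"] exI[of _ l'] exI[of _ s]) (simp add: m_assoc)
    qed
  qed simp
  then show thesis using that by blast
qed

lemma connected_avoiding_cong:
  assumes "D #> g = D #> g'" "D #> h = D #> h'" "g \<in> carrier G" "g' \<in> carrier G"
    and "connected_avoiding G a D B g h"
  shows "connected_avoiding G a D B g' h'"
  using assms walk_edges_cong[OF assms(1,3,4)] coset_mult_cong[OF assms(1,3,4)]
  by (auto simp: connected_avoiding_def)

lemma connected_avoiding_antimono:
  "connected_avoiding G a D B g h \<Longrightarrow> B' \<subseteq> B \<Longrightarrow> connected_avoiding G a D B' g h"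
  unfolding connected_avoiding_def by blast

lemma connected_avoiding_sym:
  assumes "connected_avoiding G a D B g h" "g \<in> carrier G" "h \<in> carrier G"
  shows "connected_avoiding G a D B h g"
proof -
  obtain q where q: "walk_edges G a D g q \<inter> B = {}" "D #> (g \<otimes> eval_word G a q) = D #> h"
    using assms(1) by (auto simp: connected_avoiding_def)
  have "connected_avoiding G a D B (g \<otimes> eval_word G a q) g"
    unfolding connected_avoiding_def using q(1) assms(2)
    by (intro exI[of _ "inv_word q"]) (simp add: walk_edges_inv_word eval_word_inv_word m_assoc)
  then show ?thesis using connected_avoiding_cong[OF q(2) HOL.refl] assms(2,3) by simp
qed

lemma connected_avoiding_trans:
  assumes "connected_avoiding G a D B g h" "connected_avoiding G a D B h k"
    and "g \<in> carrier G" "h \<in> carrier G"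
  shows "connected_avoiding G a D B g k"
proof -
  obtain q where q: "walk_edges G a D g q \<inter> B = {}" "D #> (g \<otimes> eval_word G a q) = D #> h"
    using assms(1) by (auto simp: connected_avoiding_def)
  have "connected_avoiding G a D B (g \<otimes> eval_word G a q) k"
    using connected_avoiding_cong[OF q(2)[symmetric] HOL.refl] assms by simp
  then obtain r where "walk_edges G a D (g \<otimes> eval_word G a q) r \<inter> B = {}"
    "D #> (g \<otimes> eval_word G a q \<otimes> eval_word G a r) = D #> k"
    by (auto simp: connected_avoiding_def)
  then show ?thesis
    unfolding connected_avoiding_def using q(1) assms(3)
    by (intro exI[of _ "q @ r"]) (auto simp: walk_edges_append eval_word_append m_assoc)
qed

text \<open>Induction on the length: either the first edge is crossed only once, or its next
  crossing cuts out a shorter reduced closed walk. The detour is required to stay inside the walk,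
  so that it survives the removal of edges elsewhere.\<close>

lemma reduced_closed_walk_nonbridge:
  assumes "reduced u" "u \<noteq> []" "g \<in> carrier G" "D #> (g \<otimes> eval_word G a u) = D #> g"
  shows "\<exists>h\<in>carrier G. \<exists>i. (D #> h, i) \<in> walk_edges G a D g u \<and>
    connected_avoiding G a D (insert (D #> h, i) (- walk_edges G a D g u)) h (h \<otimes> a i)"
  using assms
proof (induction "length u" arbitrary: u g rule: less_induct)
  case less
  obtain l u' where u: "u = l # u'" using less.prems(2) by (cases u) auto
  define g' where "g' = g \<otimes> eval_letter G a l"
  have g [simp]: "g \<in> carrier G" "g' \<in> carrier G" using less.prems(3) by (auto simp: g'_def)
  define e where "e = letter_edge G a D g l"
  have edges: "walk_edges G a D g u = insert e (walk_edges G a D g' u')"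
    by (simp add: u e_def g'_def)
  show ?case
  proof (cases "e \<in> walk_edges G a D g' u'")
    case False
    have closed: "D #> (g' \<otimes> eval_word G a u') = D #> g"
      using less.prems(4) by (simp add: u g'_def m_assoc)
    define h where "h = (if fst l then g else g \<otimes> inv a (snd l))"
    have h: "h \<in> carrier G" "e = (D #> h, snd l)"
      by (auto simp: h_def e_def letter_edge_def)
    \<comment> \<open>The rest of the walk leads from one end of e back to the other without
      crossing e again.\<close>
    have c: "connected_avoiding G a D (insert e (- walk_edges G a D g u)) g' g"
      unfolding connected_avoiding_def edges using False closed by (intro exI[of _ u']) auto
    have "connected_avoiding G a D (insert e (- walk_edges G a D g u)) h (h \<otimes> a (snd l))"
    proof (cases "fst l")
      case True
      then have "h = g" "h \<otimes> a (snd l) = g'"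
        by (auto simp: h_def g'_def eval_letter_def)
      then show ?thesis using connected_avoiding_sym[OF c] by simp
    next
      case False
      then have "h = g'" "h \<otimes> a (snd l) = g"
        by (auto simp: h_def g'_def eval_letter_def m_assoc)
      then show ?thesis using c by simp
    qed
    then show ?thesis using h edges by auto
  next
    case True
    from this g(2) obtain r l' s where u': "u' = r @ l' # s"
      and e: "e = letter_edge G a D (g' \<otimes> eval_word G a r) l'"
      by (rule in_walk_edgesE)
    \<comment> \<open>If e is crossed again in the same direction, the part from the first crossing
      up to the second is closed at g; if in the opposite direction, the part strictly between them
      is closed at g'.\<close>
    have "\<exists>v k. k \<in> carrier G \<and> length v < length u \<and> reduced v \<and> v \<noteq> [] \<and>
      D #> (k \<otimes> eval_word G a v) = D #> k \<and> walk_edges G a D k v \<subseteq> walk_edges G a D g u"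
    proof (cases "l' = l")
      case True
      then have "D #> (g' \<otimes> eval_word G a r) = D #> g"
        using e by (intro letter_edge_inj[of _ l]) (simp_all add: e_def)
      moreover have "reduced (l # r)"
        using less.prems(1) successively_append_iff[of _ "l # r" "l' # s"]
        by (simp add: u u' reduced_def)
      ultimately show ?thesis
        by (intro exI[of _ "l # r"] exI[of _ g])
          (auto simp: u u' g'_def m_assoc[symmetric] walk_edges_append)
    next
      case False
      have "snd l' = snd l" using e by (simp add: e_def letter_edge_def)
      then have l': "l' = flip_letter l"
        using False by (simp add: flip_letter_def prod_eq_iff)
      have "letter_edge G a D (g' \<otimes> eval_word G a r) l' = letter_edge G a D g' l'"
        using e letter_edge_flip[OF g(1), of l] by (simp add: l' e_def g'_def)
      then have "D #> (g' \<otimes> eval_word G a r) = D #> g'"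
        by (rule letter_edge_inj) simp_all
      \<comment> \<open>An empty r would make l and its inverse adjacent in the reduced word
        u.\<close>
      moreover have "r \<noteq> []" "reduced r"
        using less.prems(1) unfolding u u' l' reduced_def
        by (auto simp: successively_append_iff successively_Cons)
      ultimately show ?thesis
        by (intro exI[of _ r] exI[of _ g']) (auto simp: u u' g'_def walk_edges_append)
    qed
    then obtain v k where v: "k \<in> carrier G" "length v < length u" "reduced v" "v \<noteq> []"
      "D #> (k \<otimes> eval_word G a v) = D #> k" "walk_edges G a D k v \<subseteq> walk_edges G a D g u"
      by blast
    obtain h i where h: "h \<in> carrier G" "(D #> h, i) \<in> walk_edges G a D k v"
      "connected_avoiding G a D (insert (D #> h, i) (- walk_edges G a D k v)) h (h \<otimes> a i)"
      using less.hyps[OF v(2,3,4,1,5)] by blast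
    have "connected_avoiding G a D (insert (D #> h, i) (- walk_edges G a D g u)) h (h \<otimes> a i)"
      by (rule connected_avoiding_antimono[OF h(3)]) (use v(6) in auto)
    then show ?thesis using h v(6) by blast
  qed
qed

lemma walk_edges_letters:
  assumes "e \<in> walk_edges G a D g u" "g \<in> carrier G"
  shows "snd e \<in> snd ` set u"
  using assms by (induction u arbitrary: g) (force simp: letter_edge_def)+

text \<open>A position in u together with the edge of X crossed there determines the starting coset:
  translate the end of that edge back along u.\<close>

lemma finite_vertices_meeting:
  assumes "finite X"
  shows "finite {D #> g | g. g \<in> carrier G \<and> walk_edges G a D g u \<inter> X \<noteq> {}}"
proof (induction u)
  case (Cons l u)
  let ?V = "{D #> g | g. g \<in> carrier G \<and> walk_edges G a D g u \<inter> X \<noteq> {}}"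
  let ?W = "(\<lambda>c. c #> inv eval_letter G a l) ` ?V \<union> fst ` X \<union> (\<lambda>c. c #> a (snd l)) ` fst ` X"
  have key: "D #> g \<in> ?W" if g: "g \<in> carrier G" and meets: "walk_edges G a D g (l # u) \<inter> X \<noteq> {}" for g
  proof -
    consider "letter_edge G a D g l \<in> X" | "walk_edges G a D (g \<otimes> eval_letter G a l) u \<inter> X \<noteq> {}"
      using meets by auto
    then show ?thesis
    proof cases
      case 1
      show ?thesis
      proof (cases "fst l")
        case True
        then have "D #> g \<in> fst ` X"
          using imageI[OF 1, of fst] by (simp add: letter_edge_def)
        then show ?thesis by (rule UnI1[OF UnI2])
      next
        case False
        then have "D #> (g \<otimes> inv a (snd l)) \<in> fst ` X"
          using imageI[OF 1, of fst] by (simp add: letter_edge_def)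
        then have "(D #> (g \<otimes> inv a (snd l))) #> a (snd l) \<in> (\<lambda>c. c #> a (snd l)) ` fst ` X"
          by (rule imageI)
        then have "D #> g \<in> (\<lambda>c. c #> a (snd l)) ` fst ` X"
          using g D.subset by (simp add: coset_mult_assoc m_assoc)
        then show ?thesis by (rule UnI2)
      qed
    next
      case 2
      moreover have "g \<otimes> eval_letter G a l \<in> carrier G" using g by simp
      ultimately have "D #> (g \<otimes> eval_letter G a l) \<in> ?V"
        by blast
      then have "(D #> (g \<otimes> eval_letter G a l)) #> inv eval_letter G a l \<in>
          (\<lambda>c. c #> inv eval_letter G a l) ` ?V"
        by (rule imageI)
      then have "D #> g \<in> (\<lambda>c. c #> inv eval_letter G a l) ` ?V"
        using g D.subset by (simp add: coset_mult_assoc m_assoc)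
      then show ?thesis by (rule UnI1[OF UnI1])
    qed
  qed
  have "{D #> g | g. g \<in> carrier G \<and> walk_edges G a D g (l # u) \<inter> X \<noteq> {}} \<subseteq> ?W"
  proof
    fix c assume "c \<in> {D #> g | g. g \<in> carrier G \<and> walk_edges G a D g (l # u) \<inter> X \<noteq> {}}"
    then obtain g where "c = D #> g" "g \<in> carrier G" "walk_edges G a D g (l # u) \<inter> X \<noteq> {}"
      by blast
    then show "c \<in> ?W" using key by (simp only:)
  qed
  moreover have "finite ?W" using Cons assms by simp
  ultimately show ?case by (rule finite_subset)
qed simp

lemma exists_walk_avoiding:
  assumes "finite X" "infinite (rcosets D)"
  shows "\<exists>g\<in>carrier G. walk_edges G a D g u \<inter> X = {}"
proof (rule ccontr)
  assume "\<not> ?thesis"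
  then have "rcosets D \<subseteq> {D #> g | g. g \<in> carrier G \<and> walk_edges G a D g u \<inter> X \<noteq> {}}"
    unfolding RCOSETS_def by blast
  then show False
    using finite_vertices_meeting[OF assms(1)] assms(2) finite_subset by blast
qed

text \<open>Every crossing of the new edge, in either direction, is replaced by the detour between
  its ends.\<close>

lemma connected_avoiding_insert:
  assumes conn: "\<forall>g\<in>carrier G. connected_avoiding G a D B \<one> g"
    and h: "h \<in> carrier G" "connected_avoiding G a D (insert (D #> h, i) B) h (h \<otimes> a i)"
  shows "\<forall>g\<in>carrier G. connected_avoiding G a D (insert (D #> h, i) B) \<one> g"
proof -
  let ?B = "insert (D #> h, i) B"
  have step: "connected_avoiding G a D ?B g (g \<otimes> eval_letter G a l)"
    if g: "g \<in> carrier G" and "letter_edge G a D g l \<notin> B" for g l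
  proof (cases "letter_edge G a D g l = (D #> h, i)")
    case False
    then have "walk_edges G a D g [l] \<inter> ?B = {}" using that(2) by simp
    then show ?thesis
      unfolding connected_avoiding_def using g by (intro exI[of _ "[l]"]) simp
  next
    case True
    then have e: "D #> (if fst l then g else g \<otimes> inv a (snd l)) = D #> h \<and> snd l = i"
      unfolding letter_edge_def prod.inject .
    then have i: "snd l = i" by (rule conjunct2)
    have h_eq: "D #> h = D #> (if fst l then g else g \<otimes> inv a i)"
      using e by metis
    show ?thesis
    proof (cases "fst l")
      case True
      then have 1: "D #> h = D #> g" using h_eq by simp
      have "D #> (h \<otimes> a i) = D #> (g \<otimes> eval_letter G a l)"
        using coset_mult_cong[OF 1 h(1) g, of "a i"] True by (simp add: eval_letter_def i)
      with 1 show ?thesis by (rule connected_avoiding_cong[OF _ _ h(1) g h(2)])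
    next
      case False
      then have 1: "D #> h = D #> (g \<otimes> eval_letter G a l)"
        using h_eq by (simp add: eval_letter_def i)
      have "D #> (h \<otimes> a i) = D #> g"
        using coset_mult_cong[OF 1 h(1), of "a i"] g False by (simp add: eval_letter_def i m_assoc)
      with 1 have "connected_avoiding G a D ?B (g \<otimes> eval_letter G a l) g"
        by (rule connected_avoiding_cong[OF _ _ h(1) _ h(2)]) (use g in simp)
      then show ?thesis using connected_avoiding_sym[of ?B "g \<otimes> eval_letter G a l" g] g by simp
    qed
  qed
  have walk: "connected_avoiding G a D ?B g (g \<otimes> eval_word G a q)"
    if "g \<in> carrier G" "walk_edges G a D g q \<inter> B = {}" for g q
    using that
  proof (induction q arbitrary: g)
    case Nil
    then show ?case unfolding connected_avoiding_def by (intro exI[of _ "[]"]) simp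
  next
    case (Cons l q)
    have "connected_avoiding G a D ?B g (g \<otimes> eval_letter G a l)"
      using Cons.prems by (intro step) auto
    moreover have "connected_avoiding G a D ?B (g \<otimes> eval_letter G a l)
        (g \<otimes> eval_letter G a l \<otimes> eval_word G a q)"
      using Cons.prems by (intro Cons.IH) auto
    ultimately have "connected_avoiding G a D ?B g (g \<otimes> eval_letter G a l \<otimes> eval_word G a q)"
      by (rule connected_avoiding_trans) (use Cons.prems(1) in simp_all)
    then show ?case using Cons.prems(1) by (simp add: m_assoc)
  qed
  show ?thesis
  proof
    fix g assume "g \<in> carrier G"
    then obtain q where "walk_edges G a D \<one> q \<inter> B = {}" "D #> (\<one> \<otimes> eval_word G a q) = D #> g"
      using conn unfolding connected_avoiding_def by blast
    then show "connected_avoiding G a D ?B \<one> g"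
      using walk[of \<one> q]
      by (intro connected_avoiding_cong[of \<one> \<one> "\<one> \<otimes> eval_word G a q" g]) simp_all
  qed
qed

text \<open>As u has value 1 in G, it is a closed walk at every vertex. Some copy avoids A and the
  edges already chosen; it contains an edge with a detour inside that copy, hence a detour avoiding
  the earlier edges.\<close>

lemma exists_nonseparating_edges:
  assumes gen: "\<forall>g\<in>carrier G. \<exists>w. eval_word G a w = g"
    and "infinite (rcosets D)" "finite A"
    and u: "reduced u" "u \<noteq> []" "eval_word G a u = \<one>"
  shows "\<exists>B. finite B \<and> card B = n \<and> A \<inter> B = {} \<and>
    (\<forall>e\<in>B. \<exists>h\<in>carrier G. \<exists>i\<in>snd ` set u. e = (D #> h, i)) \<and>
    (\<forall>g\<in>carrier G. connected_avoiding G a D B \<one> g)"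
proof (induction n)
  case 0
  have "connected_avoiding G a D {} \<one> g" if "g \<in> carrier G" for g
    using bspec[OF gen that] that by (auto simp: connected_avoiding_def)
  then show ?case by (intro exI[of _ "{}"]) auto
next
  case (Suc n)
  then obtain B where B: "finite B" "card B = n" "A \<inter> B = {}"
    "\<forall>e\<in>B. \<exists>h\<in>carrier G. \<exists>i\<in>snd ` set u. e = (D #> h, i)"
    "\<forall>g\<in>carrier G. connected_avoiding G a D B \<one> g"
    by blast
  obtain g where g: "g \<in> carrier G" "walk_edges G a D g u \<inter> (A \<union> B) = {}"
    using exists_walk_avoiding[of "A \<union> B" u] assms(2,3) B(1) by auto
  obtain h i where h: "h \<in> carrier G" "(D #> h, i) \<in> walk_edges G a D g u"
    "connected_avoiding G a D (insert (D #> h, i) (- walk_edges G a D g u)) h (h \<otimes> a i)"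
    using reduced_closed_walk_nonbridge[OF u(1,2) g(1)] g(1) u(3) by auto
  have new: "(D #> h, i) \<notin> A" "(D #> h, i) \<notin> B" "i \<in> snd ` set u"
    using h(2) g(2) walk_edges_letters[OF h(2) g(1)] by auto
  have "connected_avoiding G a D (insert (D #> h, i) B) h (h \<otimes> a i)"
    by (rule connected_avoiding_antimono[OF h(3)]) (use g(2) in auto)
  then have "\<forall>g\<in>carrier G. connected_avoiding G a D (insert (D #> h, i) B) \<one> g"
    by (rule connected_avoiding_insert[OF B(5) h(1)])
  then show ?case
    using B new h(1) by (intro exI[of _ "insert (D #> h, i) B"]) auto
qed

text \<open>A word for a generator of D is a closed walk at the vertex D, so products and inverses
  of generators use the same finitely many edges again.\<close>

lemma finitely_many_edges_reach_subgroup: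
  assumes gen: "\<forall>g\<in>carrier G. \<exists>w. eval_word G a w = g"
    and "finite S" "S \<subseteq> D" "generate G S = D"
  shows "\<exists>A. finite A \<and> (\<forall>d\<in>D. \<exists>u. eval_word G a u = d \<and> walk_edges G a D \<one> u \<subseteq> A)"
proof -
  have "\<exists>f. \<forall>s\<in>S. eval_word G a (f s) = s"
    using gen assms(3) D.subset by (intro bchoice) blast
  then obtain f where f: "\<And>s. s \<in> S \<Longrightarrow> eval_word G a (f s) = s" by blast
  define A where "A = (\<Union>s\<in>S. walk_edges G a D \<one> (f s))"
  have fin: "finite (walk_edges G a D g u)" for g u
    by (induction u arbitrary: g) auto
  have "\<exists>u. eval_word G a u = d \<and> walk_edges G a D \<one> u \<subseteq> A" if "d \<in> generate G S" for d
    using that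
  proof (induction rule: generate.induct)
    case one
    show ?case by (intro exI[of _ "[]"]) simp
  next
    case (incl d)
    then show ?case using f by (intro exI[of _ "f d"]) (auto simp: A_def)
  next
    case (inv d)
    have "D #> d = D #> \<one>"
      using coset_left_mult[of d \<one>] inv assms(3) by auto
    then have "walk_edges G a D d (inv_word (f d)) = walk_edges G a D \<one> (inv_word (f d))"
      using inv assms(3) D.subset by (intro walk_edges_cong) auto
    then have "walk_edges G a D \<one> (inv_word (f d)) = walk_edges G a D \<one> (f d)"
      using walk_edges_inv_word[of \<one> "f d"] f[OF inv] inv assms(3) D.subset by auto
    then show ?case
      using f inv by (intro exI[of _ "inv_word (f d)"]) (auto simp: A_def eval_word_inv_word)
  next
    case (eng d d')
    then obtain u v where uv: "eval_word G a u = d" "walk_edges G a D \<one> u \<subseteq> A"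
      "eval_word G a v = d'" "walk_edges G a D \<one> v \<subseteq> A"
      by blast
    have "d \<in> D" using eng(1) assms(4) by simp
    then have "D #> d = D #> \<one>" "d \<in> carrier G"
      using coset_left_mult[of d \<one>] D.subset by auto
    then have "walk_edges G a D d v = walk_edges G a D \<one> v"
      by (intro walk_edges_cong) auto
    then show ?case
      using uv \<open>d \<in> carrier G\<close>
      by (intro exI[of _ "u @ v"]) (auto simp: walk_edges_append eval_word_append)
  qed
  then show ?thesis
    using fin assms(2,4) by (intro exI[of _ A]) (auto simp: A_def)
qed

text \<open>Each of the n loops crosses its own private edge exactly once, and the endpoints in D of
  their lifts to G are prescribed.\<close>

lemma exists_loops:
  fixes n :: nat
  assumes gen: "\<forall>g\<in>carrier G. \<exists>w. eval_word G a w = g"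
    and inf: "infinite (rcosets D)"
    and S: "finite S" "S \<subseteq> D" "generate G S = D"
    and u: "reduced u" "u \<noteq> []" "eval_word G a u = \<one>"
    and b: "\<And>i. b i \<in> D"
  obtains e p k q where "inj_on e {..<n}"
    "\<And>i. i < n \<Longrightarrow> k i \<in> snd ` set u"
    "\<And>i. i < n \<Longrightarrow> e i = (D #> eval_word G a (p i), k i)"
    "\<And>i. i < n \<Longrightarrow> eval_word G a (p i @ (True, k i) # q i) = b i"
    "\<And>i. i < n \<Longrightarrow> walk_edges G a D \<one> (p i) \<inter> e ` {..<n} = {}"
    "\<And>i. i < n \<Longrightarrow> walk_edges G a D (eval_word G a (p i) \<otimes> a (k i)) (q i) \<inter> e ` {..<n} = {}"
proof -
  obtain A where A: "finite A" "\<forall>d\<in>D. \<exists>u. eval_word G a u = d \<and> walk_edges G a D \<one> u \<subseteq> A"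
    using finitely_many_edges_reach_subgroup[OF gen S] by (elim exE conjE)
  obtain B where B: "finite B" "card B = n" "A \<inter> B = {}"
    "\<forall>e\<in>B. \<exists>h\<in>carrier G. \<exists>i\<in>snd ` set u. e = (D #> h, i)"
    "\<forall>g\<in>carrier G. connected_avoiding G a D B \<one> g"
    using exists_nonseparating_edges[OF gen inf A(1) u, of n] by (elim exE conjE)
  obtain e where e: "bij_betw e {..<n} B"
    using ex_bij_betw_nat_finite[OF B(1)] unfolding B(2) atLeast0LessThan by blast
  then have eB: "e ` {..<n} = B" by (simp add: bij_betw_def)
  have "\<exists>p k q. k \<in> snd ` set u \<and> e i = (D #> eval_word G a p, k) \<and>
      eval_word G a (p @ (True, k) # q) = b i \<and> walk_edges G a D \<one> p \<inter> B = {} \<and>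
      walk_edges G a D (eval_word G a p \<otimes> a k) q \<inter> B = {}" if "i < n" for i
  proof -
    have "e i \<in> B" using that eB by auto
    then obtain h k where h: "h \<in> carrier G" "k \<in> snd ` set u" "e i = (D #> h, k)"
      using B(4) by blast
    obtain t where t: "walk_edges G a D \<one> t \<inter> B = {}" "D #> eval_word G a t = D #> h"
      using bspec[OF B(5) h(1)] by (auto simp: connected_avoiding_def)
    have "connected_avoiding G a D B (h \<otimes> a k) \<one>"
      using connected_avoiding_sym[of B \<one> "h \<otimes> a k"] bspec[OF B(5), of "h \<otimes> a k"] h(1) by simp
    then obtain q where q: "walk_edges G a D (h \<otimes> a k) q \<inter> B = {}"
      "D #> (h \<otimes> a k \<otimes> eval_word G a q) = D #> \<one>"
      by (auto simp: connected_avoiding_def)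
    \<comment> \<open>Going by t to the tail of e(i), across it and back by q ends at c in D, which
      need not be b(i). A walk v with value b(i) c^-1 put in front corrects this; its edges lie in
      A, so it crosses no private edge.\<close>
    define c where "c = eval_word G a t \<otimes> (a k \<otimes> eval_word G a q)"
    have c: "c \<in> carrier G" by (simp add: c_def)
    have "D #> c = D #> (h \<otimes> (a k \<otimes> eval_word G a q))"
      unfolding c_def using t(2) h(1) by (intro coset_mult_cong) auto
    then have "D #> c = D"
      using q(2) h(1) D.subset by (simp add: m_assoc)
    then have "c \<in> D" using coset_join1 c D_subgroup by blast
    then have "b i \<otimes> inv c \<in> D" using b by simp
    then obtain v where v: "eval_word G a v = b i \<otimes> inv c" "walk_edges G a D \<one> v \<subseteq> A"
      using A(2) by blast
    have bi: "b i \<in> carrier G" using b D.subset by blast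
    have cos: "D #> (eval_word G a v \<otimes> x) = D #> x" if "x \<in> carrier G" for x
      unfolding v(1) using \<open>b i \<otimes> inv c \<in> D\<close> that by (rule coset_left_mult)
    have pt: "D #> eval_word G a (v @ t) = D #> h"
      using cos t(2) by (simp add: eval_word_append)
    have "walk_edges G a D (eval_word G a v) t = walk_edges G a D \<one> t"
      using cos[of \<one>] by (intro walk_edges_cong) auto
    then have p_edges: "walk_edges G a D \<one> (v @ t) \<inter> B = {}"
      using v(2) t(1) B(3) by (auto simp: walk_edges_append)
    have "walk_edges G a D (eval_word G a (v @ t) \<otimes> a k) q = walk_edges G a D (h \<otimes> a k) q"
      using coset_mult_cong[OF pt, of "a k"] h(1) by (intro walk_edges_cong) auto
    with q(1) have q_edges: "walk_edges G a D (eval_word G a (v @ t) \<otimes> a k) q \<inter> B = {}"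
      by simp
    have "eval_word G a ((v @ t) @ (True, k) # q) = b i \<otimes> inv c \<otimes> c"
      unfolding v(1)[symmetric] by (simp add: eval_word_append c_def eval_letter_def m_assoc)
    then have "eval_word G a ((v @ t) @ (True, k) # q) = b i"
      using bi c by (simp add: m_assoc)
    moreover have "e i = (D #> eval_word G a (v @ t), k)"
      using h(3) pt by (simp only:)
    ultimately show ?thesis
      using h(2) p_edges q_edges by blast
  qed
  then obtain p k q where "\<And>i. i < n \<Longrightarrow> k i \<in> snd ` set u \<and> e i = (D #> eval_word G a (p i), k i) \<and>
      eval_word G a (p i @ (True, k i) # q i) = b i \<and> walk_edges G a D \<one> (p i) \<inter> B = {} \<and>
      walk_edges G a D (eval_word G a (p i) \<otimes> a (k i)) (q i) \<inter> B = {}"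
    by metis
  then show thesis
    using e by (intro that[of e k p q]) (auto simp: bij_betw_def)
qed

end

section \<open>Laws in two variables\<close>

lemma not_reducedE:
  assumes "\<not> reduced w"
  obtains p b i s where "w = p @ [(b, i), (\<not> b, i)] @ s"
proof -
  have "\<exists>p b i s. w = p @ [(b, i), (\<not> b, i)] @ s"
    using assms
  proof (induction w)
    case (Cons l w)
    show ?case
    proof (cases "reduced w")
      case True
      then have "w \<noteq> []" "hd w = flip_letter l"
        using Cons.prems by (auto simp: reduced_def successively_Cons)
      then have "l # w = [] @ [(fst l, snd l), (\<not> fst l, snd l)] @ tl w"
        by (cases w) (auto simp: flip_letter_def)
      then show ?thesis by blast
    next
      case False
      then obtain p b i s where "w = p @ [(b, i), (\<not> b, i)] @ s"
        using Cons.IH by blast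
      then have "l # w = (l # p) @ [(b, i), (\<not> b, i)] @ s" by simp
      then show ?thesis by blast
    qed
  qed (simp add: reduced_def)
  then show thesis using that by blast
qed

lemma exists_reduced: "\<exists>r. freeq w r \<and> reduced r"
proof (induction "length w" arbitrary: w rule: less_induct)
  case less
  show ?case
  proof (cases "reduced w")
    case True
    then show ?thesis using freeq.refl by blast
  next
    case False
    then obtain p b i s where w: "w = p @ [(b, i), (\<not> b, i)] @ s"
      by (rule not_reducedE)
    then obtain r where "freeq (p @ s) r" "reduced r"
      using less[of "p @ s"] by auto
    then show ?thesis unfolding w using freeq.trans freeq.cancel by blast
  qed
qed

definition power_word :: "int \<Rightarrow> word" where
  "power_word k = replicate (nat \<bar>k\<bar>) (0 \<le> k, 0)"

text \<open>The reduced form of x^(-p) times the value of w under the embedding of the free group of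
  infinite rank into the free group on x and y that sends the i-th variable to x^i y x^(-i).\<close>

fun two_letter_word :: "nat \<Rightarrow> word \<Rightarrow> word" where
  "two_letter_word p [] = power_word (- int p)"
| "two_letter_word p ((b, i) # w) = power_word (int i - int p) @ (b, 1) # two_letter_word i w"

lemma two_letter_word_letters: "snd ` set (two_letter_word p w) \<subseteq> {0, 1}"
  by (induction p w rule: two_letter_word.induct) (auto simp: power_word_def)

lemma reduced_replicate_append:
  "reduced v \<Longrightarrow> v = [] \<or> hd v \<noteq> flip_letter l \<Longrightarrow> reduced (replicate k l @ v)"
proof (induction k)
  case (Suc k)
  have "l \<noteq> flip_letter l" by (simp add: flip_letter_def prod_eq_iff)
  then show ?case
    using Suc by (cases k) (auto simp: reduced_def successively_Cons)
qed simp

text \<open>Two successive occurrences of y are separated by x^(i-p). This is empty only if their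
  indices agree, and then their signs agree because the given word is reduced.\<close>

lemma reduced_two_letter_word_Cons:
  "reduced ((b, p) # w) \<Longrightarrow> reduced ((b, 1) # two_letter_word p w)"
proof (induction w arbitrary: b p)
  case Nil
  have "reduced (power_word (- int p))"
    unfolding power_word_def
    using reduced_replicate_append[of "[]"] by (simp add: reduced_def)
  then show ?case by (auto simp: reduced_def power_word_def successively_Cons hd_replicate)
next
  case (Cons l w)
  obtain b' i where l: "l = (b', i)" by (cases l)
  have IH: "reduced ((b', 1) # two_letter_word i w)"
    using Cons by (auto simp: l reduced_def)
  show ?case
  proof (cases "i = p")
    case True
    then have "b' = b" using Cons.prems by (auto simp: l reduced_def)
    then show ?thesis
      using IH True by (simp add: l power_word_def reduced_def)
  next
    case False
    then have "reduced (power_word (int i - int p) @ (b', 1) # two_letter_word i w)"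
      unfolding power_word_def using IH by (intro reduced_replicate_append) auto
    moreover have "power_word (int i - int p) \<noteq> []" "snd (hd (power_word (int i - int p))) = 0"
      using False by (auto simp: power_word_def)
    ultimately show ?thesis
      by (auto simp: l reduced_def successively_Cons)
  qed
qed

lemma reduced_two_letter_word:
  assumes "reduced w" "w \<noteq> []"
  shows "reduced (two_letter_word p w)"
proof -
  obtain b i w' where w: "w = (b, i) # w'" using assms(2) by (cases w) auto
  then show ?thesis
    unfolding w two_letter_word.simps power_word_def
    using reduced_two_letter_word_Cons[of b i w'] assms(1)[unfolded w]
    by (intro reduced_replicate_append) auto
qed

context group
begin

lemma eval_power_word:
  assumes "range a \<subseteq> carrier G"
  shows "eval_word G a (power_word k) = a 0 [^] k"
proof -
  have a: "a 0 \<in> carrier G" using assms by auto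
  have pow: "eval_word G a (replicate n (b, 0)) = eval_letter G a (b, 0) [^] n" for n b
  proof (induction n)
    case (Suc n)
    have "eval_word G a (replicate (Suc n) (b, 0)) =
        eval_letter G a (b, 0) \<otimes> eval_letter G a (b, 0) [^] n"
      using Suc by simp
    also have "\<dots> = eval_letter G a (b, 0) [^] Suc n"
      by (rule nat_pow_Suc2[symmetric]) (use assms in simp)
    finally show ?case .
  qed simp
  show ?thesis
  proof (cases k rule: int_cases2)
    case (nonneg n)
    then show ?thesis unfolding power_word_def pow by (simp add: eval_letter_def int_pow_int)
  next
    case (nonpos n)
    then show ?thesis
      unfolding power_word_def pow using nat_pow_inv[OF a, of n] a
      by (simp add: eval_letter_def int_pow_neg_int)
  qed
qed

lemma eval_two_letter_word:
  assumes "range a \<subseteq> carrier G"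
  shows "eval_word G a (two_letter_word p w) =
    a 0 [^] (- int p) \<otimes> eval_word G (\<lambda>i. a 0 [^] int i \<otimes> a 1 \<otimes> a 0 [^] (- int i)) w"
proof (induction w arbitrary: p)
  case Nil
  have "a 0 \<in> carrier G" using assms by auto
  then show ?case using assms by (simp add: eval_power_word)
next
  case (Cons l w)
  obtain b i where l: "l = (b, i)" by (cases l)
  have a: "a 0 \<in> carrier G" "a (Suc 0) \<in> carrier G" using assms by auto
  define c where "c = (\<lambda>i. a 0 [^] int i \<otimes> a 1 \<otimes> a 0 [^] (- int i))"
  have c: "range c \<subseteq> carrier G" using a by (auto simp: c_def)
  have letter: "eval_letter G c (b, i) = a 0 [^] int i \<otimes> eval_letter G a (b, 1) \<otimes> a 0 [^] (- int i)"
    using a by (auto simp: eval_letter_def c_def inv_mult_group int_pow_neg m_assoc)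
  have "a 0 [^] (int i - int p) = a 0 [^] (- int p) \<otimes> a 0 [^] int i"
    using a by (simp add: int_pow_mult[symmetric])
  then show ?case
    using Cons assms a c unfolding c_def[symmetric]
    by (simp add: l eval_word_append eval_power_word letter m_assoc)
qed

text \<open>The law is evaluated at the conjugates a(0)^i a(1) a(0)^-i. Triviality of u at the given
  \<open>a\<close> is all that is needed to close its walks.\<close>

lemma exists_two_letter_law:
  assumes "range a \<subseteq> carrier G" "satisfies_law G w" "\<not> freeq w []"
  obtains u where "reduced u" "u \<noteq> []" "snd ` set u \<subseteq> {0, 1}" "eval_word G a u = \<one>"
proof -
  obtain r where r: "freeq w r" "reduced r" using exists_reduced by blast
  then have "r \<noteq> []" using assms(3) by auto
  define c where "c = (\<lambda>i. a 0 [^] int i \<otimes> a 1 \<otimes> a 0 [^] (- int i))"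
  have a: "a 0 \<in> carrier G" "a (Suc 0) \<in> carrier G" using assms by auto
  have c: "range c \<subseteq> carrier G" using a by (auto simp: c_def)
  then have "eval_word G c r = \<one>"
    using assms(2) eval_word_freeq[OF r(1) c] by (simp add: satisfies_law_def image_subset_iff)
  then have "eval_word G a (two_letter_word 0 r) = \<one>"
    using eval_two_letter_word[OF assms(1), of 0 r] by (simp add: c_def)
  moreover have "two_letter_word 0 r \<noteq> []"
    using \<open>r \<noteq> []\<close> by (cases r) auto
  ultimately show thesis
    using reduced_two_letter_word[OF r(2) \<open>r \<noteq> []\<close>]
    by (intro that[of "two_letter_word 0 r"] two_letter_word_letters)
qed

end

section \<open>Separating words by labellings\<close>

text \<open>The homomorphism is recorded by the images b(i) of the free generators; injectivity on
  the classes of P lets equal values in D be pulled back to the V-free group.\<close>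

lemma discriminates_rel_free_variety:
  assumes "group G" "subgroup D G"
    and "discriminates (G\<lparr>carrier := D\<rparr>) (rel_free (in_variety L))" "finite P"
  obtains b where "\<And>i. b i \<in> D"
    "\<And>u v. u \<in> P \<Longrightarrow> v \<in> P \<Longrightarrow> eval_word G b u = eval_word G b v \<Longrightarrow>
       word_class (u @ inv_word v) \<in> rel_free_kernel (in_variety L)"
proof -
  let ?R = "rel_free_kernel (in_variety L)"
  let ?F = "free_group Mod ?R"
  let ?x = "\<lambda>i. ?R #>\<^bsub>free_group\<^esub> word_class [(True, i)]"
  note R = normal_rel_free_kernel_variety[of L]
  interpret G: group G by fact
  have "(\<lambda>u. ?R #>\<^bsub>free_group\<^esub> word_class u) ` P \<subseteq> carrier ?F"
    by (auto simp: carrier_FactGroup)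
  then obtain h where h: "h \<in> hom ?F (G\<lparr>carrier := D\<rparr>)"
    "inj_on h ((\<lambda>u. ?R #>\<^bsub>free_group\<^esub> word_class u) ` P)"
    using assms(3,4) unfolding discriminates_def rel_free_eq by blast
  interpret h: group_hom ?F "G\<lparr>carrier := D\<rparr>" h
    using h(1) normal.factorgroup_is_group[OF R] G.subgroup_imp_group[OF assms(2)]
    by (simp add: group_hom_def group_hom_axioms_def)
  define b where "b = (\<lambda>i. h (?x i))"
  have x: "?x i \<in> carrier ?F" for i
    by (auto simp: carrier_FactGroup)
  have b: "b i \<in> D" for i
    using h.hom_closed[OF x] by (simp add: b_def)
  have eval: "eval_word G b u = h (?R #>\<^bsub>free_group\<^esub> word_class u)" for u
  proof -
    have "h (eval_word ?F ?x u) = eval_word (G\<lparr>carrier := D\<rparr>) b u"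
      unfolding b_def using x by (intro h.hom_eval_word) auto
    also have "\<dots> = eval_word G b u"
      using b by (intro G.eval_word_subgroup[OF assms(2)]) auto
    finally show ?thesis
      by (simp add: eval_word_free_quotient[OF R] subst_word_letters)
  qed
  show thesis
  proof (rule that[of b])
    show "b i \<in> D" for i by (rule b)
    show "word_class (u @ inv_word v) \<in> ?R"
      if "u \<in> P" "v \<in> P" "eval_word G b u = eval_word G b v" for u v
      using inj_onD[OF h(2)] that unfolding word_class_coset_eq_iff[OF R, symmetric] eval by blast
  qed
qed

lemma rel_free_kernel_variety_eval_mem:
  fixes q :: "nat \<Rightarrow> 'q"
  assumes "M \<lhd> Q" "range q \<subseteq> carrier Q"
    and L: "\<And>w q. w \<in> L \<Longrightarrow> range q \<subseteq> carrier Q \<Longrightarrow> eval_word Q q w \<in> M"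
    and "word_class w \<in> rel_free_kernel (in_variety L)"
  shows "eval_word Q q w \<in> M"
proof -
  interpret M: normal M Q by fact
  have "in_variety L (Q Mod M)"
    unfolding in_variety_FactGroup_iff[OF assms(1)] using L by blast
  moreover have "range (\<lambda>i. M #>\<^bsub>Q\<^esub> q i) \<subseteq> carrier (Q Mod M)"
    using assms(2) by (auto simp: carrier_FactGroup)
  ultimately have "eval_word (Q Mod M) (\<lambda>i. M #>\<^bsub>Q\<^esub> q i) w = \<one>\<^bsub>Q Mod M\<^esub>"
    using assms(4) by (rule in_variety_rel_free_kernel_eval)
  then show ?thesis
    using eval_word_FactGroup[OF assms(1,2)] M.r_coset_eq_one_iff assms(2) by simp
qed

text \<open>A walk along the b(i) that starts in D never leaves it, so labels outside D are never
  read.\<close>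

lemma path_label_cong:
  assumes "group G" "subgroup D G" "range b \<subseteq> D"
    and "\<And>d i. d \<in> D \<Longrightarrow> i \<in> snd ` set w \<Longrightarrow> lam d i = lam' d i" "g \<in> D"
  shows "path_label M G b lam g w = path_label M G b lam' g w"
  using assms(4,5)
proof (induction w arbitrary: g)
  case (Cons l w)
  interpret group G by fact
  interpret D: subgroup D G by fact
  have b: "b i \<in> D" for i using assms(3) by auto
  have "edge_label M G b lam g l = edge_label M G b lam' g l"
    using Cons.prems b by (auto simp: edge_label_def)
  moreover have "g \<otimes>\<^bsub>G\<^esub> eval_letter G b l \<in> D"
    using Cons.prems b by (auto simp: eval_letter_def)
  ultimately show ?case
    using Cons.IH[of "g \<otimes>\<^bsub>G\<^esub> eval_letter G b l"] Cons.prems(1) by simp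
qed simp

text \<open>The labels in the subgroup M are quotients of consecutive values of T along the walk, so the
  product telescopes; the junk value 1 is never met because T agrees with q modulo M.\<close>

lemma path_label_telescope:
  assumes "group G" and b: "\<And>i. b i \<in> carrier G"
    and "group Q" "subgroup M Q" and q: "\<And>i. q i \<in> carrier Q"
    and T: "\<And>g. T g \<in> carrier Q"
    and prefix: "\<And>f r. w = f @ r \<Longrightarrow> T (eval_word G b f) \<otimes>\<^bsub>Q\<^esub> inv\<^bsub>Q\<^esub> eval_word Q q f \<in> M"
  defines "lab \<equiv> \<lambda>g i. T g \<otimes>\<^bsub>Q\<^esub> q i \<otimes>\<^bsub>Q\<^esub> inv\<^bsub>Q\<^esub> T (g \<otimes>\<^bsub>G\<^esub> b i)"
  shows "path_label (Q\<lparr>carrier := M\<rparr>) G b (\<lambda>g i. if lab g i \<in> M then lab g i else \<one>\<^bsub>Q\<^esub>) \<one>\<^bsub>G\<^esub> w =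
    T \<one>\<^bsub>G\<^esub> \<otimes>\<^bsub>Q\<^esub> eval_word Q q w \<otimes>\<^bsub>Q\<^esub> inv\<^bsub>Q\<^esub> T (eval_word G b w)"
proof -
  let ?M = "Q\<lparr>carrier := M\<rparr>"
  let ?lam = "\<lambda>g i. if lab g i \<in> M then lab g i else \<one>\<^bsub>Q\<^esub>"
  interpret G: group G by fact
  interpret Q: group Q by fact
  interpret M: subgroup M Q by fact
  have rb: "range b \<subseteq> carrier G" and rq: "range q \<subseteq> carrier Q" using b q by auto
  have edge: "edge_label ?M G b ?lam (eval_word G b f) l =
      T (eval_word G b f) \<otimes>\<^bsub>Q\<^esub> eval_letter Q q l \<otimes>\<^bsub>Q\<^esub> inv\<^bsub>Q\<^esub> T (eval_word G b (f @ [l]))"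
    if "w = f @ l # r" for f l r
  proof -
    have m: "T (eval_word G b f) \<otimes>\<^bsub>Q\<^esub> inv\<^bsub>Q\<^esub> eval_word Q q f \<in> M"
      "T (eval_word G b (f @ [l])) \<otimes>\<^bsub>Q\<^esub> inv\<^bsub>Q\<^esub> eval_word Q q (f @ [l]) \<in> M"
      using prefix[of f "l # r"] prefix[of "f @ [l]" r] that by auto
    let ?x = "T (eval_word G b f) \<otimes>\<^bsub>Q\<^esub> eval_letter Q q l \<otimes>\<^bsub>Q\<^esub> inv\<^bsub>Q\<^esub> T (eval_word G b (f @ [l]))"
    \<comment> \<open>The label is the quotient of two errors T / q at consecutive prefixes, each in
      M by \<open>prefix\<close>.\<close>
    have "(T (eval_word G b f) \<otimes>\<^bsub>Q\<^esub> inv\<^bsub>Q\<^esub> eval_word Q q f) \<otimes>\<^bsub>Q\<^esub>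
      inv\<^bsub>Q\<^esub> (T (eval_word G b (f @ [l])) \<otimes>\<^bsub>Q\<^esub> inv\<^bsub>Q\<^esub> eval_word Q q (f @ [l])) \<in> M"
      using m by simp
    also have "(T (eval_word G b f) \<otimes>\<^bsub>Q\<^esub> inv\<^bsub>Q\<^esub> eval_word Q q f) \<otimes>\<^bsub>Q\<^esub>
        inv\<^bsub>Q\<^esub> (T (eval_word G b (f @ [l])) \<otimes>\<^bsub>Q\<^esub> inv\<^bsub>Q\<^esub> eval_word Q q (f @ [l])) =
      T (eval_word G b f) \<otimes>\<^bsub>Q\<^esub> (inv\<^bsub>Q\<^esub> eval_word Q q f \<otimes>\<^bsub>Q\<^esub> (eval_word Q q f \<otimes>\<^bsub>Q\<^esub>
        (eval_letter Q q l \<otimes>\<^bsub>Q\<^esub> inv\<^bsub>Q\<^esub> T (eval_word G b (f @ [l])))))"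
      using T rq by (simp add: Q.inv_mult_group Q.eval_word_append Q.m_assoc)
    also have "\<dots> = T (eval_word G b f) \<otimes>\<^bsub>Q\<^esub>
        (eval_letter Q q l \<otimes>\<^bsub>Q\<^esub> inv\<^bsub>Q\<^esub> T (eval_word G b (f @ [l])))"
      by (subst Q.m_assoc[symmetric]) (use T rq in simp_all)
    also have "\<dots> = ?x"
      using T rq by (simp add: Q.m_assoc)
    finally have x: "?x \<in> M" .
    show ?thesis
    proof (cases "fst l")
      case True
      have "eval_word G b (f @ [l]) = eval_word G b f \<otimes>\<^bsub>G\<^esub> b (snd l)"
        using True b rb by (simp add: G.eval_word_append eval_letter_def)
      then show ?thesis
        using True x by (simp add: edge_label_def eval_letter_def lab_def)
    next
      case False
      define g where "g = eval_word G b (f @ [l])"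
      have g: "eval_word G b f \<otimes>\<^bsub>G\<^esub> inv\<^bsub>G\<^esub> b (snd l) = g" "eval_word G b f = g \<otimes>\<^bsub>G\<^esub> b (snd l)"
        using False b rb by (simp_all add: g_def G.eval_word_append eval_letter_def G.m_assoc)
      \<comment> \<open>Read backwards, the edge starts at the later vertex g, and its label is the
        inverse of the quotient wanted.\<close>
      have inv: "lab g (snd l) = inv\<^bsub>Q\<^esub> ?x"
        using False T q unfolding g_def[symmetric]
        by (simp add: lab_def g(2)[symmetric] eval_letter_def Q.inv_mult_group Q.m_assoc)
      then have "lab g (snd l) \<in> M" using x by simp
      moreover have "inv\<^bsub>Q\<^esub> lab g (snd l) = ?x"
        unfolding inv using x by (intro Q.inv_inv) (rule M.mem_carrier)
      ultimately show ?thesis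
        using False by (simp add: edge_label_def g(1) Q.m_inv_consistent[OF assms(4)])
    qed
  qed
  have "path_label ?M G b ?lam (eval_word G b f) r =
      T (eval_word G b f) \<otimes>\<^bsub>Q\<^esub> eval_word Q q r \<otimes>\<^bsub>Q\<^esub> inv\<^bsub>Q\<^esub> T (eval_word G b w)"
    if "w = f @ r" for f r
    using that
  proof (induction r arbitrary: f)
    case Nil
    then show ?case using T by simp
  next
    case (Cons l r)
    have step: "eval_word G b f \<otimes>\<^bsub>G\<^esub> eval_letter G b l = eval_word G b (f @ [l])"
      using rb by (simp add: G.eval_word_append)
    have IH: "path_label ?M G b ?lam (eval_word G b (f @ [l])) r =
      T (eval_word G b (f @ [l])) \<otimes>\<^bsub>Q\<^esub> eval_word Q q r \<otimes>\<^bsub>Q\<^esub> inv\<^bsub>Q\<^esub> T (eval_word G b w)"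
      using Cons by simp
    define t where "t = T (eval_word G b (f @ [l]))"
    have t: "t \<in> carrier Q" using T by (simp add: t_def)
    have cancel: "inv\<^bsub>Q\<^esub> t \<otimes>\<^bsub>Q\<^esub> (t \<otimes>\<^bsub>Q\<^esub> y) = y" if "y \<in> carrier Q" for y
      using that t by (simp add: Q.m_assoc[symmetric])
    show ?case
      unfolding path_label.simps step edge[OF Cons.prems] IH t_def[symmetric]
      using T rq t by (simp add: Q.m_assoc cancel)
  qed
  from this[of "[]" w] show ?thesis by simp
qed

section \<open>Labellings supported above the private edges\<close>

context schreier_graph
begin

lemma path_label_avoiding:
  assumes "group M" "\<And>h i. h \<in> carrier G \<Longrightarrow> (D #> h, i) \<notin> B \<Longrightarrow> lam h i = \<one>\<^bsub>M\<^esub>"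
    and "g \<in> carrier G" "walk_edges G a D g w \<inter> B = {}"
  shows "path_label M G a lam g w = \<one>\<^bsub>M\<^esub>"
  using assms(3,4)
proof (induction w arbitrary: g)
  case (Cons l w)
  interpret M: group M by fact
  have "edge_label M G a lam g l = \<one>\<^bsub>M\<^esub>"
    using Cons.prems assms(2)[of g "snd l"] assms(2)[of "g \<otimes> inv a (snd l)" "snd l"]
    by (auto simp: edge_label_def letter_edge_def)
  moreover have "path_label M G a lam (g \<otimes> eval_letter G a l) w = \<one>\<^bsub>M\<^esub>"
    using Cons.prems by (intro Cons.IH) auto
  ultimately show ?case by simp
qed simp

text \<open>The edges are private in the coset graph but the labels live on the Cayley graph, where
  e(i) has one lift on the loop from each d in D. These lifts can be labelled independently.\<close>

lemma exists_labelling_of_loops: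
  fixes n :: nat
  assumes e: "inj_on e {..<n}"
    "\<And>i. i < n \<Longrightarrow> e i = (D #> eval_word G a (p i), k i)"
    "\<And>i. i < n \<Longrightarrow> walk_edges G a D \<one> (p i) \<inter> e ` {..<n} = {}"
    "\<And>i. i < n \<Longrightarrow> walk_edges G a D (eval_word G a (p i) \<otimes> a (k i)) (q i) \<inter> e ` {..<n} = {}"
    and "group M" and lab: "\<And>g i. lab g i \<in> carrier M"
  shows "\<exists>lam. (\<forall>g i. lam g i \<in> carrier M) \<and>
    (\<forall>g i. lam g i \<noteq> \<one>\<^bsub>M\<^esub> \<longrightarrow> (\<exists>j<n. i = k j)) \<and>
    (\<forall>d\<in>D. \<forall>i<n. path_label M G a lam d (p i @ (True, k i) # q i) = lab d i)"
proof -
  interpret M: group M by fact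
  define B where "B = e ` {..<n}"
  \<comment> \<open>A lift of e(j) with tail g is crossed by the j-th loop started at g p(j)^-1, so
    that start determines the label; injectivity of e makes j unique.\<close>
  define lam where "lam = (\<lambda>g i. if (D #> g, i) \<in> B
    then (let j = the_inv_into {..<n} e (D #> g, i) in lab (g \<otimes> inv eval_word G a (p j)) j)
    else \<one>\<^bsub>M\<^esub>)"
  have lam: "lam g i \<in> carrier M" for g i
    using lab by (simp add: lam_def Let_def)
  interpret edge_labelling G M a lam
    using lam by unfold_locales auto
  have one: "lam h i = \<one>\<^bsub>M\<^esub>" if "(D #> h, i) \<notin> B" for h i
    using that by (simp add: lam_def)
  show ?thesis
  proof (intro exI[of _ lam] conjI allI ballI impI)
    show "lam g i \<in> carrier M" for g i by (rule lam)
    show "\<exists>j<n. i = k j" if "lam g i \<noteq> \<one>\<^bsub>M\<^esub>" for g i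
    proof -
      have "(D #> g, i) \<in> B" using that one by blast
      then obtain j where "j < n" "e j = (D #> g, i)" by (auto simp: B_def)
      then show ?thesis using e(2)[of j] by auto
    qed
    fix d i assume d: "d \<in> D" and i: "i < n"
    have dG: "d \<in> carrier G" using d D.subset by blast
    let ?p = "eval_word G a (p i)"
    have "walk_edges G a D d (p i) = walk_edges G a D \<one> (p i)"
      using coset_left_mult[OF d, of \<one>] dG by (intro walk_edges_cong) auto
    then have 1: "path_label M G a lam d (p i) = \<one>\<^bsub>M\<^esub>"
      using e(3)[OF i] dG by (intro path_label_avoiding[of M B] M.group_axioms one) (auto simp: B_def)
    have "walk_edges G a D (d \<otimes> ?p \<otimes> a (k i)) (q i) = walk_edges G a D (?p \<otimes> a (k i)) (q i)"
      using coset_left_mult[OF d, of "?p \<otimes> a (k i)"] dG by (intro walk_edges_cong) (auto simp: m_assoc)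
    then have 2: "path_label M G a lam (d \<otimes> ?p \<otimes> a (k i)) (q i) = \<one>\<^bsub>M\<^esub>"
      using e(4)[OF i] dG by (intro path_label_avoiding[of M B] M.group_axioms one) (auto simp: B_def)
    have ei: "(D #> (d \<otimes> ?p), k i) = e i"
      using coset_left_mult[OF d, of ?p] e(2)[OF i] by simp
    have "the_inv_into {..<n} e (e i) = i"
      using e(1) i by (intro the_inv_into_f_f) auto
    moreover have "d \<otimes> ?p \<otimes> inv ?p = d" using dG by (simp add: m_assoc)
    moreover have "e i \<in> B" using i by (simp add: B_def)
    ultimately have "lam (d \<otimes> ?p) (k i) = lab d i"
      unfolding lam_def ei by simp
    then show "path_label M G a lam d (p i @ (True, k i) # q i) = lab d i"
      using dG lab by (simp add: path_label_append 1 2 edge_label_def eval_letter_def)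
  qed
qed

end

lemma finite_prefixes: "finite {f. \<exists>r. w = f @ r}"
proof (rule finite_subset)
  show "{f. \<exists>r. w = f @ r} \<subseteq> (\<lambda>i. take i w) ` {..length w}"
  proof
    fix f assume "f \<in> {f. \<exists>r. w = f @ r}"
    then obtain r where "w = f @ r" by blast
    then have "f = take (length f) w" "length f \<le> length w" by simp_all
    then show "f \<in> (\<lambda>i. take i w) ` {..length w}" by blast
  qed
qed simp

context generated_group
begin

lemma labelling_detects_word:
  fixes n :: nat
  assumes "in_variety LV G" "subgroup D G" and b: "\<And>i. b i \<in> D"
    and e: "inj_on e {..<n}"
    "\<And>i. i < n \<Longrightarrow> e i = (D #> eval_word G a (p i), k i)"
    "\<And>i. i < n \<Longrightarrow> walk_edges G a D \<one> (p i) \<inter> e ` {..<n} = {}"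
    "\<And>i. i < n \<Longrightarrow> walk_edges G a D (eval_word G a (p i) \<otimes> a (k i)) (q i) \<inter> e ` {..<n} = {}"
    and k: "\<And>i. i < n \<Longrightarrow> k i < m"
    and s: "\<And>i. eval_word G a (s i) = b i" "\<And>i. i < n \<Longrightarrow> s i = p i @ (True, k i) # q i"
    and w: "snd ` set w \<subseteq> {..<n}" "word_class w \<in> rel_free_kernel (in_variety LV)"
      "word_class w \<notin> rel_free_kernel (in_product LU LV)"
    and inj: "\<And>f f' r r'. w = f @ r \<Longrightarrow> w = f' @ r' \<Longrightarrow> eval_word G b f = eval_word G b f' \<Longrightarrow>
      word_class (f @ inv_word f') \<in> rel_free_kernel (in_variety LV)"
  shows "\<not> trivial_in_extensions LU G a m (subst_word s w)"
proof
  assume trivial: "trivial_in_extensions LU G a m (subst_word s w)"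
  interpret schreier_graph G a D
    using assms(2) group_axioms by (simp add: schreier_graph_def schreier_graph_axioms_def)
  have bG: "b i \<in> carrier G" for i using b D.subset by blast
  obtain Q :: "word set set monoid" and x where Q: "group Q" "in_product LU LV Q" "range x \<subseteq> carrier Q" "eval_word Q x w \<noteq> \<one>\<^bsub>Q\<^esub>"
    using w(3) by (rule not_in_rel_free_kernelE)
  obtain N where N: "N \<lhd> Q"
    and LU: "\<And>w c. w \<in> LU \<Longrightarrow> range c \<subseteq> N \<Longrightarrow> eval_word Q c w = \<one>\<^bsub>Q\<^esub>"
    and LV: "\<And>w c. w \<in> LV \<Longrightarrow> range c \<subseteq> carrier Q \<Longrightarrow> eval_word Q c w \<in> N"
    using Q(2) unfolding in_product_iff by blast
  interpret Q: group Q by fact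
  interpret N: normal N Q by fact
  have x: "x i \<in> carrier Q" for i using Q(3) by auto
  let ?M = "Q\<lparr>carrier := N\<rparr>"
  have M: "group ?M" by (rule Q.subgroup_imp_group[OF N.subgroup_axioms])
  have varM: "in_variety LU ?M"
    unfolding Q.in_variety_subgroup_iff[OF N.subgroup_axioms] using LU by blast
  \<comment> \<open>Several prefixes may reach g; one is chosen. By \<open>prefix\<close> below, the
    choice changes T only modulo N.\<close>
  define T where "T = (\<lambda>g. if \<exists>f r. w = f @ r \<and> eval_word G b f = g
    then eval_word Q x (SOME f. \<exists>r. w = f @ r \<and> eval_word G b f = g) else \<one>\<^bsub>Q\<^esub>)"
  have T: "T g \<in> carrier Q" for g using Q(3) by (simp add: T_def)
  have prefix: "T (eval_word G b f) \<otimes>\<^bsub>Q\<^esub> inv\<^bsub>Q\<^esub> eval_word Q x f \<in> N" if "w = f @ r" for f r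
  proof -
    define f' where "f' = (SOME f'. \<exists>r. w = f' @ r \<and> eval_word G b f' = eval_word G b f)"
    have "\<exists>r. w = f' @ r \<and> eval_word G b f' = eval_word G b f"
      unfolding f'_def by (rule someI[of _ f]) (use that in blast)
    then obtain r' where f': "w = f' @ r'" "eval_word G b f' = eval_word G b f" by blast
    have "T (eval_word G b f) = eval_word Q x f'"
      unfolding T_def f'_def using that by auto
    \<comment> \<open>Both prefixes have the same value in D, so by injectivity they differ by a law
      of V, whose values lie in N.\<close>
    moreover have "eval_word Q x (f' @ inv_word f) \<in> N"
      by (rule rel_free_kernel_variety_eval_mem[OF N Q(3) LV inj[OF f'(1) that f'(2)]])
    ultimately show ?thesis
      using Q(3) by (simp add: Q.eval_word_append Q.eval_word_inv_word)
  qed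
  define lab0 where "lab0 = (\<lambda>g i. T g \<otimes>\<^bsub>Q\<^esub> x i \<otimes>\<^bsub>Q\<^esub> inv\<^bsub>Q\<^esub> T (g \<otimes> b i))"
  define lab where "lab = (\<lambda>g i. if lab0 g i \<in> N then lab0 g i else \<one>\<^bsub>Q\<^esub>)"
  have lab: "lab g i \<in> carrier ?M" for g i by (simp add: lab_def)
  have "\<exists>lam. (\<forall>g i. lam g i \<in> carrier ?M) \<and>
    (\<forall>g i. lam g i \<noteq> \<one>\<^bsub>?M\<^esub> \<longrightarrow> (\<exists>j<n. i = k j)) \<and>
    (\<forall>d\<in>D. \<forall>i<n. path_label ?M G a lam d (p i @ (True, k i) # q i) = lab d i)"
    by (rule exists_labelling_of_loops) (fact e M lab)+
  then obtain lam where lam: "\<forall>g i. lam g i \<in> carrier ?M"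
    "\<forall>g i. lam g i \<noteq> \<one>\<^bsub>?M\<^esub> \<longrightarrow> (\<exists>j<n. i = k j)"
    "\<forall>d\<in>D. \<forall>i<n. path_label ?M G a lam d (p i @ (True, k i) # q i) = lab d i"
    by (elim exE conjE)
  have "extension_labelling LU G m ?M lam"
    unfolding extension_labelling_def using varM lam(1) lam(2) k by (metis leD)
  then have "\<one>\<^bsub>?M\<^esub> = path_label ?M G a lam \<one> (subst_word s w)"
    using trivial_in_extensionsD(2)[OF trivial] by simp
  also have "\<dots> = path_label ?M G b (\<lambda>g i. path_label ?M G a lam g (s i)) \<one> w"
    using edge_labelling.path_label_subst[OF edge_labelling_extension, of LU ?M lam \<one> s w]
      \<open>extension_labelling LU G m ?M lam\<close> s(1) by simp
  also have "\<dots> = path_label ?M G b lab \<one> w"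
  proof (rule path_label_cong[OF group_axioms assms(2)])
    show "path_label ?M G a lam d (s i) = lab d i" if "d \<in> D" "i \<in> snd ` set w" for d i
      using that w(1) s(2) lam(3) by auto
  qed (use b in auto)
  also have "\<dots> = T \<one> \<otimes>\<^bsub>Q\<^esub> eval_word Q x w \<otimes>\<^bsub>Q\<^esub> inv\<^bsub>Q\<^esub> T (eval_word G b w)"
    unfolding lab_def lab0_def
    by (rule path_label_telescope[OF group_axioms bG Q(1) N.subgroup_axioms x T prefix])
  \<comment> \<open>The walk ends where it began, which leaves a conjugate of the value of w by
    \<open>T \<one>\<close>. That element need not be 1, since the prefix chosen for it may be
    nonempty.\<close>
  also have "eval_word G b w = \<one>"
    using bG by (intro in_variety_rel_free_kernel_eval[OF assms(1) _ w(2)]) auto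
  finally have "T \<one> \<otimes>\<^bsub>Q\<^esub> eval_word Q x w \<otimes>\<^bsub>Q\<^esub> inv\<^bsub>Q\<^esub> T \<one> = \<one>\<^bsub>Q\<^esub>"
    by simp
  then have "T \<one> \<otimes>\<^bsub>Q\<^esub> eval_word Q x w = T \<one>"
    using Q.inv_equality[of "T \<one> \<otimes>\<^bsub>Q\<^esub> eval_word Q x w" "inv\<^bsub>Q\<^esub> T \<one>"] T Q(3) by simp
  then show False
    using Q(3,4) T Q.r_cancel_one'[of "eval_word Q x w" "T \<one>"] Q.l_cancel_one[of "T \<one>" "eval_word Q x w"]
    by simp
qed

text \<open>One substitution must serve all words at once: those nontrivial in the V-free group are
  seen in G by any lift of the b(i), which leaves the lifts free to serve the others.\<close>

lemma exists_separating_substitution: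
  assumes "2 \<le> m" "in_variety LV G"
    and gen: "\<forall>g\<in>carrier G. \<exists>w. eval_word G a w = g"
    and D: "subgroup D G" "infinite (rcosets D)"
    and S: "finite S" "S \<subseteq> D" "generate G S = D"
    and disc: "discriminates (G\<lparr>carrier := D\<rparr>) (rel_free (in_variety LV))"
    and "finite W"
    and W: "\<And>w. w \<in> W \<Longrightarrow> word_class w \<notin> rel_free_kernel (in_product LU LV)"
  shows "\<exists>s. \<forall>w\<in>W. \<not> trivial_in_extensions LU G a m (subst_word s w)"
proof -
  interpret schreier_graph G a D
    using D(1) group_axioms by (simp add: schreier_graph_def schreier_graph_axioms_def)
  \<comment> \<open>Each w is among its own prefixes; comparing it with the empty word shows that
    its value in D is not 1 when w is no law of V.\<close>
  define P where "P = insert [] (\<Union>w\<in>W. {f. \<exists>r. w = f @ r})"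
  have "finite P" using \<open>finite W\<close> by (simp add: P_def finite_prefixes)
  obtain b where b: "\<And>i. b i \<in> D"
    and inj: "\<And>u v. u \<in> P \<Longrightarrow> v \<in> P \<Longrightarrow> eval_word G b u = eval_word G b v \<Longrightarrow>
       word_class (u @ inv_word v) \<in> rel_free_kernel (in_variety LV)"
    by (rule discriminates_rel_free_variety[OF group_axioms D(1) disc \<open>finite P\<close>]) (rule that)
  have outside: "\<not> trivial_in_extensions LU G a m (subst_word s w)"
    if s: "\<And>i. eval_word G a (s i) = b i" and "w \<in> W"
      and w: "word_class w \<notin> rel_free_kernel (in_variety LV)" for s w
  proof
    assume "trivial_in_extensions LU G a m (subst_word s w)"
    then have "eval_word G b w = eval_word G b []"
      using trivial_in_extensionsD(1) by (fastforce simp: eval_word_subst s)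
    moreover have "w \<in> P" "[] \<in> P" using \<open>w \<in> W\<close> by (auto simp: P_def)
    ultimately show False using inj[of w "[]"] w by simp
  qed
  have "\<forall>i. \<exists>u. eval_word G a u = b i"
    using gen b D.subset by blast
  then obtain s0 where s0: "\<And>i. eval_word G a (s0 i) = b i" by metis
  show ?thesis
  \<comment> \<open>With no word of W trivial in the V-free group, any lift works. This case covers
    the variety of all groups, where the coset graph may have only bridges outside a finite
    part.\<close>
  proof (cases "\<exists>w0\<in>W. word_class w0 \<in> rel_free_kernel (in_variety LV)")
    case False
    then show ?thesis using outside[of s0] s0 by blast
  next
    case True
    then obtain w0 where w0: "w0 \<in> W" "word_class w0 \<in> rel_free_kernel (in_variety LV)"
      by blast
    have "\<not> freeq w0 []"
    proof
      assume "freeq w0 []"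
      then have "word_class w0 = \<one>\<^bsub>free_group\<^esub>"
        unfolding free_group_one word_class_eq_iff .
      then show False
        using W[OF w0(1)] subgroup.one_closed[OF normal_imp_subgroup[OF normal_rel_free_kernel_product]]
        by simp
    qed
    moreover have "satisfies_law G w0"
      unfolding satisfies_law_def
      using in_variety_rel_free_kernel_eval[OF assms(2) _ w0(2)] by (auto simp: image_subset_iff)
    ultimately obtain u where u: "reduced u" "u \<noteq> []" "snd ` set u \<subseteq> {0, 1}" "eval_word G a u = \<one>"
      using exists_two_letter_law[OF range_a] by metis
    have "finite (\<Union>w\<in>W. snd ` set w)" using \<open>finite W\<close> by simp
    then obtain n where n: "\<And>w. w \<in> W \<Longrightarrow> snd ` set w \<subseteq> {..<n}"
      unfolding finite_nat_set_iff_bounded by blast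
    obtain e p k q where e: "inj_on e {..<n}"
      "\<And>i. i < n \<Longrightarrow> k i \<in> snd ` set u"
      "\<And>i. i < n \<Longrightarrow> e i = (D #> eval_word G a (p i), k i)"
      "\<And>i. i < n \<Longrightarrow> eval_word G a (p i @ (True, k i) # q i) = b i"
      "\<And>i. i < n \<Longrightarrow> walk_edges G a D \<one> (p i) \<inter> e ` {..<n} = {}"
      "\<And>i. i < n \<Longrightarrow> walk_edges G a D (eval_word G a (p i) \<otimes> a (k i)) (q i) \<inter> e ` {..<n} = {}"
      by (rule exists_loops[where b = b and n = n, OF gen D(2) S u(1,2,4) b]) (rule that)
    \<comment> \<open>Since u has only the variables 0 and 1, the private edges carry generators
      that are allowed nontrivial labels.\<close>
    have k: "k i < m" if "i < n" for i
    proof -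
      have "k i \<in> {0, 1}" using e(2)[OF that] u(3) by blast
      then show ?thesis using \<open>2 \<le> m\<close> by auto
    qed
    define s where "s = (\<lambda>i. if i < n then p i @ (True, k i) # q i else s0 i)"
    have s: "eval_word G a (s i) = b i" for i
      using e(4) s0 by (simp add: s_def del: eval_word_Cons)
    have "\<not> trivial_in_extensions LU G a m (subst_word s w)"
      if "w \<in> W" "word_class w \<in> rel_free_kernel (in_variety LV)" for w
    proof (rule labelling_detects_word[OF assms(2) D(1) b e(1,3,5,6) k s])
      show "s i = p i @ (True, k i) # q i" if "i < n" for i using that by (simp add: s_def)
      show "word_class (f @ inv_word f') \<in> rel_free_kernel (in_variety LV)"
        if "w = f @ r" "w = f' @ r'" "eval_word G b f = eval_word G b f'" for f f' r r'
      proof (rule inj)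
        show "f \<in> P" "f' \<in> P" using \<open>w \<in> W\<close> that(1,2) unfolding P_def by blast+
      qed (fact that(3))
    qed (use that n W in auto)
    then show ?thesis using outside[of s] s by blast
  qed
qed

end

text \<open>Take a homomorphism to H injective on the value of w at the free generators and 1: a law
  of H identifies the two, so they were already equal.\<close>

lemma rel_free_discriminated_law:
  assumes "group H" "discriminates H (rel_free (in_product LU LV))" "satisfies_law H w"
  shows "word_class w \<in> rel_free_kernel (in_product LU LV)"
proof -
  let ?R = "rel_free_kernel (in_product LU LV)"
  let ?F = "free_group Mod ?R"
  let ?x = "\<lambda>i. ?R #>\<^bsub>free_group\<^esub> word_class [(True, i)]"
  note R = normal_rel_free_kernel_product[of LU LV]
  have x: "range ?x \<subseteq> carrier ?F" by (auto simp: carrier_FactGroup)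
  interpret F: group ?F using R by (rule normal.factorgroup_is_group)
  have "\<exists>h\<in>hom ?F H. inj_on h {eval_word ?F ?x w, \<one>\<^bsub>?F\<^esub>}"
    using F.eval_word_closed[OF x] F.one_closed
    by (intro assms(2)[unfolded discriminates_def rel_free_eq, rule_format]) blast
  then obtain h where h: "h \<in> hom ?F H" "inj_on h {eval_word ?F ?x w, \<one>\<^bsub>?F\<^esub>}"
    by (elim bexE)
  interpret h: group_hom ?F H h
    using h(1) assms(1) F.group_axioms by (simp add: group_hom_def group_hom_axioms_def)
  have "\<forall>i. h (?x i) \<in> carrier H" using x by (simp add: image_subset_iff)
  then have "h (eval_word ?F ?x w) = h \<one>\<^bsub>?F\<^esub>"
    using assms(3) h.hom_eval_word[OF x] h.hom_one by (simp add: satisfies_law_def)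
  then have "eval_word ?F ?x w = \<one>\<^bsub>?F\<^esub>"
    by (rule inj_onD[OF h(2)]) blast+
  then show ?thesis
    using normal.r_coset_eq_one_iff[OF R]
    by (simp add: eval_word_free_quotient[OF R] subst_word_letters)
qed

theorem theorem3:
  fixes LU LV :: "word set"
    and G :: "'g monoid"
    and D :: "'g set"
    and m :: nat
  assumes "m \<ge> 2"
    and "in_variety LV G"
    and "m_generated G m"
    and "subgroup D G"
    and "\<exists>S. finite S \<and> S \<subseteq> D \<and> generate G S = D"
    and "infinite (rcosets\<^bsub>G\<^esub> D)"
    and "discriminates (G\<lparr>carrier := D\<rparr>) (rel_free (in_variety LV))"
  shows "(\<exists>H :: word set set monoid. m_generated H m \<and> in_product LU LV H \<and>
            discriminates H (rel_free (in_product LU LV)))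
       \<and> (\<forall>w. (\<forall>H :: word set set monoid. in_product LU LV H \<and> m_generated H m
                  \<longrightarrow> satisfies_law H w)
              \<longrightarrow> (\<forall>K :: 'k monoid. in_product LU LV K \<longrightarrow> satisfies_law K w))"
proof -
  interpret group G using assms(2) by (simp add: in_variety_def)
  obtain xs where xs: "length xs = m" "set xs \<subseteq> carrier G" "generate G (set xs) = carrier G"
    using assms(3) unfolding m_generated_def by blast
  define a where "a = (\<lambda>i. if i < m then xs ! i else \<one>\<^bsub>G\<^esub>)"
  interpret generated_group G a m
    using xs(1,2) by unfold_locales (auto simp: a_def subset_iff)
  have "set xs \<subseteq> range a"
    using xs(1) by (auto simp: a_def in_set_conv_nth image_iff)
  then have "carrier G \<subseteq> generate G (range a)"
    using mono_generate xs(3) by blast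
  then have gen: "\<forall>g\<in>carrier G. \<exists>w. eval_word G a w = g"
    using exists_word_generate[OF range_a] by blast
  obtain S where S: "finite S" "S \<subseteq> D" "generate G S = D"
    using assms(5) by blast
  let ?K = "extension_kernel LU G a m"
  let ?H = "free_group Mod ?K"
  let ?R = "rel_free_kernel (in_product LU LV)"
  note K = normal_extension_kernel[of LU] and R = normal_rel_free_kernel_product[of LU LV]
  have H: "m_generated ?H m" "in_product LU LV ?H"
    using m_generated_extension in_product_extension[OF assms(2)] by blast+
  then have group_H: "group ?H" by (simp add: in_product_def)
  have disc: "discriminates ?H (rel_free (in_product LU LV))"
    unfolding discriminates_def
  proof (intro allI impI)
    fix X assume X: "finite X \<and> X \<subseteq> carrier (rel_free (in_product LU LV))"
    then have "X \<subseteq> range (\<lambda>u. ?R #>\<^bsub>free_group\<^esub> word_class u)"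
      by (auto simp: rel_free_eq elim!: free_quotientE)
    then obtain U where U: "finite U" "X = (\<lambda>u. ?R #>\<^bsub>free_group\<^esub> word_class u) ` U"
      using X by (metis finite_subset_image)
    \<comment> \<open>Injectivity on X amounts to keeping the quotients of distinct elements of X
      nontrivial.\<close>
    define W where "W = {u @ inv_word v | u v. u \<in> U \<and> v \<in> U \<and> word_class (u @ inv_word v) \<notin> ?R}"
    have "W \<subseteq> (\<lambda>(u, v). u @ inv_word v) ` (U \<times> U)" by (auto simp: W_def)
    then have "finite W" using U(1) finite_subset by blast
    moreover have "word_class w \<notin> ?R" if "w \<in> W" for w using that by (auto simp: W_def)
    ultimately obtain s where s: "\<And>w. w \<in> W \<Longrightarrow> \<not> trivial_in_extensions LU G a m (subst_word s w)"
      using exists_separating_substitution[OF assms(1,2) gen assms(4,6) S assms(7)] by metis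
    have y: "range (\<lambda>i. ?K #>\<^bsub>free_group\<^esub> word_class (s i)) \<subseteq> carrier ?H"
      by (auto simp: carrier_FactGroup)
    obtain h where h: "h \<in> hom (free_group Mod ?R) ?H"
      "\<And>u. h (?R #>\<^bsub>free_group\<^esub> word_class u) =
         eval_word ?H (\<lambda>i. ?K #>\<^bsub>free_group\<^esub> word_class (s i)) u"
      using free_quotient_hom[OF R group_H y in_product_rel_free_kernel_eval[OF H(2) y]] by metis
    have "inj_on h X"
    proof (rule inj_onI)
      fix A B assume "A \<in> X" "B \<in> X" and eq: "h A = h B"
      then obtain u v where uv: "u \<in> U" "v \<in> U" "A = ?R #>\<^bsub>free_group\<^esub> word_class u"
        "B = ?R #>\<^bsub>free_group\<^esub> word_class v"
        using U(2) by blast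
      have "word_class (subst_word s (u @ inv_word v)) \<in> ?K"
        using eq unfolding uv(3,4) h(2) eval_word_free_quotient[OF K] word_class_coset_eq_iff[OF K]
        by (simp add: subst_word_inv_word)
      then have "u @ inv_word v \<notin> W"
        using s word_class_in_extension_kernel_iff by blast
      then have "word_class (u @ inv_word v) \<in> ?R"
        using uv(1,2) unfolding W_def by blast
      then show "A = B"
        unfolding uv(3,4) word_class_coset_eq_iff[OF R] .
    qed
    then show "\<exists>h\<in>hom (rel_free (in_product LU LV)) ?H. inj_on h X"
      using h(1) unfolding rel_free_eq by blast
  qed
  \<comment> \<open>The bound on the basis rank: a law of all m-generated groups of UV holds in the
    discriminating group, hence in the UV-free group, hence in every group of UV.\<close>
  have "satisfies_law L w"
    if "\<forall>H :: word set set monoid. in_product LU LV H \<and> m_generated H m \<longrightarrow> satisfies_law H w"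
      and "in_product LU LV L" for w and L :: "'k monoid"
  proof -
    have "word_class w \<in> ?R"
      using that(1) H rel_free_discriminated_law[OF group_H disc] by blast
    then show ?thesis
      unfolding satisfies_law_def
      using in_product_rel_free_kernel_eval[OF that(2)] by (auto simp: image_subset_iff)
  qed
  then show ?thesis using H disc by blast
qed

end
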